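(* Let $g\in H^\infty(\mathbb{D})$ be such that $g(\mathbb{D})\cap\mathbb{D}=\varnothing$, $|g|>1$ almost everywhere on $\mathbb{T}$, and $\log(|g|-1)\in L^1(\mathbb{T})$. Then the operator $T_g^*$ on $H^2(\mathbb{D})$ is not $1$-weakly hypercyclic.
   Context: $\mathbb{D}$ is the open unit disk, $\mathbb{T}$ the unit circle with normalized Lebesgue measure; functions in $H^\infty(\mathbb{D})$ are identified with their boundary values on $\mathbb{T}$. $H^2(\mathbb{D})\subseteq L^2(\mathbb{T})$; for $g\in L^\infty(\mathbb{T})$, $T_g=PM_g$ where $M_g$ is multiplication by $g$ and $P$ is the orthogonal projection of $L^2(\mathbb{T})$ onto $H^2(\mathbb{D})$; $T_g^*$ is the Hilbert space adjoint. An operator $T$ on a complex Banach space $X$ is $1$-weakly hypercyclic if there is $x\in X$ such that for every non-zero continuous linear functional $f$ on $X$, the set $\{f(T^mx):m\in\mathbb{Z}_+\}$ is dense in $\mathbb{C}$. *)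

theory Defs
  imports "HOL-Analysis.Analysis"
begin

definition circle_measure :: "complex measure" where
  "circle_measure = distr (uniform_measure lborel {0..2*pi}) borel cis"

definition L2T :: "(complex \<Rightarrow> complex) set" where
  "L2T = {f. f \<in> borel_measurable circle_measure \<and>
              integrable circle_measure (\<lambda>z. (cmod (f z))^2)}"

definition l2_inner :: "(complex \<Rightarrow> complex) \<Rightarrow> (complex \<Rightarrow> complex) \<Rightarrow> complex" where
  "l2_inner f h = integral\<^sup>L circle_measure (\<lambda>z. f z * cnj (h z))"

definition l2_norm :: "(complex \<Rightarrow> complex) \<Rightarrow> real" where
  "l2_norm f = sqrt (integral\<^sup>L circle_measure (\<lambda>z. (cmod (f z))^2))"

definition fourier_coeff :: "(complex \<Rightarrow> complex) \<Rightarrow> int \<Rightarrow> complex" where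
  "fourier_coeff f k = integral\<^sup>L circle_measure (\<lambda>z. f z * cnj (z powi k))"

definition H2 :: "(complex \<Rightarrow> complex) set" where
  "H2 = {f \<in> L2T. \<forall>k::int. k < 0 \<longrightarrow> fourier_coeff f k = 0}"

definition boundary_value :: "(complex \<Rightarrow> complex) \<Rightarrow> complex \<Rightarrow> complex" where
  "boundary_value g z = Lim (at_left (1::real)) (\<lambda>r. g (complex_of_real r * z))"

definition Hinfty :: "(complex \<Rightarrow> complex) set" where
  "Hinfty = {g. g holomorphic_on ball 0 1 \<and> bounded (g ` ball 0 1)}"

definition cont_lin_functional_H2 :: "((complex \<Rightarrow> complex) \<Rightarrow> complex) \<Rightarrow> bool" where
  "cont_lin_functional_H2 \<phi> \<longleftrightarrow>
     (\<forall>f\<in>H2. \<forall>h\<in>H2. \<phi> (\<lambda>z. f z + h z) = \<phi> f + \<phi> h) \<and>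
     (\<forall>f\<in>H2. \<forall>c. \<phi> (\<lambda>z. c * f z) = c * \<phi> f) \<and>
     (\<forall>f\<in>H2. \<forall>e>0. \<exists>d>0. \<forall>h\<in>H2. l2_norm (\<lambda>z. h z - f z) < d \<longrightarrow> cmod (\<phi> h - \<phi> f) < e)"

definition one_weakly_hypercyclic_H2 :: "((complex \<Rightarrow> complex) \<Rightarrow> (complex \<Rightarrow> complex)) \<Rightarrow> bool" where
  "one_weakly_hypercyclic_H2 T \<longleftrightarrow>
     (\<exists>x\<in>H2. \<forall>\<phi>. cont_lin_functional_H2 \<phi> \<and> (\<exists>f\<in>H2. \<phi> f \<noteq> 0) \<longrightarrow>
        closure (range (\<lambda>m::nat. \<phi> ((T ^^ m) x))) = UNIV)"

end

theory Submission
  imports Defs "HOL-Complex_Analysis.Complex_Analysis" "HOL-Probability.Probability_Measure"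
begin

text \<open>
  Write \<open>G\<close> for the boundary function of \<open>g\<close>, which exists by Fatou's theorem. If \<open>x \<noteq> 0\<close>, pick \<open>j\<close> with
  \<open>\<langle>z\<^sup>j, x\<rangle> \<noteq> 0\<close>. Since \<open>1 / g\<close> is a bounded analytic function, \<open>f = exp (- Q) z\<^sup>j / G\<^sup>m\<close> lies in \<open>H\<^sup>2\<close> for every
  polynomial \<open>Q\<close>, and \<open>\<langle>f, A\<^sup>m x\<rangle> = \<langle>exp (- Q) z\<^sup>j, x\<rangle>\<close>. Integrability of \<open>log (\<bar>G\<bar> - 1)\<close> lets one choose \<open>Q\<close> with
  \<open>Re Q \<ge> 0\<close> on the circle and \<open>Q(0)\<close> small, so that \<open>exp (- Q)\<close> is close to \<open>1\<close> in \<open>H\<^sup>2\<close>, and with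
  \<open>Re Q\<close> so close to the part of \<open>- 2 log (min 1 (\<bar>G\<bar> - 1))\<close> above a fixed level that the norm of \<open>f\<close> is at most a constant times \<open>m\<^sup>-\<^sup>2\<close>.
  Hence the norm of \<open>A\<^sup>m x\<close> grows at least like \<open>m\<^sup>2\<close>. Bang's lemma on plank coverings then yields signs \<open>s\<^sub>j\<close>
  such that, with \<open>e\<^sub>j\<close> the normalised vectors \<open>A\<^sup>j x\<close>, the functional \<open>\<Sum>j. s\<^sub>j (j + 1)\<^sup>-\<^sup>2 \<langle>\<cdot>, e\<^sub>j\<rangle>\<close> is bounded
  away from \<open>0\<close> along the orbit of \<open>x\<close>.
\<close>

section \<open>Normalised Lebesgue measure on the circle\<close>

text \<open>Without the factor \<open>exp (- Q)\<close> there is no rate: \<open>|G| > 1\<close>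
  makes \<open>1 / G\<^sup>m\<close> tend to zero pointwise, but \<open>|G| - 1\<close> need not be
  bounded below, so its norm may decay arbitrarily slowly. Damping where \<open>|G|\<close> is near
  1 repairs this: for \<open>t = min 1 (|G| - 1)\<close> the product
  \<open>t\<^sup>4 |G|\<^sup>-\<^sup>2\<^sup>m\<close> is at most \<open>81 / m\<^sup>4\<close>.
  Damping by the whole logarithm would destroy closeness to 1. Keeping only its part above a level
  \<open>n\<close> makes the mean of \<open>Re Q\<close>, which is \<open>Re Q(0)\<close>, as small
  as desired, at the price of a factor \<open>exp (2 n)\<close> that does not depend on
  \<open>m\<close>. The growth exponent 2 matters because the functional must give
  \<open>e\<^sub>m\<close> a value of order \<open>1 / \<parallel>A\<^sup>m x\<parallel>\<close>,
  while its weights have to be summable for continuity. The \<open>e\<^sub>j\<close> are not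
  orthogonal, so with careless signs the terms could cancel; this is what Bang's lemma excludes.
  Fatou's theorem links the data on the circle, given through \<open>boundary_value g\<close>, with
  the bound \<open>|g| \<ge> 1\<close> inside the disc, which is what puts
  \<open>1 / G\<^sup>m\<close> into \<open>H2\<close>.\<close>

lemma sets_circle_measure [measurable_cong, simp]: "sets circle_measure = sets borel"
  by (simp add: circle_measure_def)

lemma space_circle_measure [simp]: "space circle_measure = UNIV"
  by (simp add: circle_measure_def)

lemma measurable_cis [measurable]: "cis \<in> borel_measurable borel"
  by (intro borel_measurable_continuous_onI continuous_intros)

lemma measurable_cnj [measurable]: "cnj \<in> borel_measurable borel"
  by (intro borel_measurable_continuous_onI continuous_intros)

interpretation circle: prob_space circle_measure
  unfolding circle_measure_def
  by (intro prob_space.prob_space_distr prob_space_uniform_measure) simp_all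

lemma AE_circle: "AE z in circle_measure. cmod z = 1"
  unfolding circle_measure_def by (subst AE_distr_iff) auto

text \<open>Cauchy's theorem delivers gauge integrals over \<open>{0..2*pi}\<close>; the uniform
  bound on the circle supplies the absolute integrability that identifies them with Lebesgue
  integrals.\<close>

lemma integral_circle_eq:
  fixes f :: "complex \<Rightarrow> complex"
  assumes [measurable]: "f \<in> borel_measurable borel"
    and int: "((\<lambda>t. f (cis t)) has_integral I) {0..2*pi}"
    and bnd: "\<And>z. cmod z = 1 \<Longrightarrow> cmod (f z) \<le> B"
  shows "integral\<^sup>L circle_measure f = I / (2 * pi)"
proof -
  have si: "integrable lborel (\<lambda>t. indicator {0..2*pi} t *\<^sub>R f (cis t))"
    by (rule integrableI_bounded_set[of "{0..2*pi}" _ _ B]) (auto intro!: AE_I2 bnd)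
  have "integral\<^sup>L circle_measure f = integral\<^sup>L (uniform_measure lborel {0..2*pi}) (\<lambda>t. f (cis t))"
    unfolding circle_measure_def by (rule integral_distr) auto
  also have "\<dots> = integral\<^sup>L lborel (\<lambda>t. (indicator {0..2*pi} t / (2*pi)) *\<^sub>R f (cis t))"
  proof -
    have "uniform_measure lborel {0..2*pi} = density lborel (\<lambda>t. ennreal (indicator {0..2*pi} t / (2*pi)))"
      unfolding uniform_measure_def
      by (rule density_cong) (auto split: split_indicator simp: divide_ennreal[symmetric])
    then show ?thesis
      by (simp add: integral_density)
  qed
  also have "\<dots> = integral\<^sup>L lborel (\<lambda>t. (1/(2*pi)) *\<^sub>R (indicator {0..2*pi} t *\<^sub>R f (cis t)))"
    by (intro Bochner_Integration.integral_cong) auto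
  also have "\<dots> = (1/(2*pi)) *\<^sub>R integral\<^sup>L lborel (\<lambda>t. indicator {0..2*pi} t *\<^sub>R f (cis t))"
    by (rule integral_scaleR_right)
  also have "integral\<^sup>L lborel (\<lambda>t. indicator {0..2*pi} t *\<^sub>R f (cis t)) = I"
  proof -
    have "((\<lambda>t. indicator {0..2*pi} t *\<^sub>R f (cis t)) has_integral I) UNIV"
    proof -
      have "(\<lambda>t. indicator {0..2*pi} t *\<^sub>R f (cis t)) = (\<lambda>t. if t \<in> {0..2*pi} then f (cis t) else 0)"
        by (auto simp: fun_eq_iff)
      then show ?thesis
        using int by (simp only: has_integral_restrict_UNIV)
    qed
    then show ?thesis
      using has_integral_integral_lborel[OF si] has_integral_unique by blast
  qed
  finally show ?thesis
    by (simp add: scaleR_conv_of_real field_simps)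
qed

lemma continuous_on_cball_bounded:
  fixes h :: "complex \<Rightarrow> complex"
  assumes "continuous_on (cball 0 1) h"
  shows "\<exists>B. \<forall>z. cmod z \<le> 1 \<longrightarrow> cmod (h z) \<le> B"
proof -
  have "bounded (h ` cball 0 1)"
    by (intro compact_imp_bounded compact_continuous_image assms compact_cball)
  then obtain B where "\<And>y. y \<in> h ` cball 0 1 \<Longrightarrow> cmod y \<le> B"
    unfolding bounded_iff by blast
  then show ?thesis
    by (intro exI[of _ B]) auto
qed

text \<open>On the circle \<open>cnj w = 1 / w\<close>, so
  \<open>1 / (1 - a * cnj w) = w / (w - a)\<close>. The extra \<open>w\<close> is the one in
  \<open>dw = i w dt\<close>, and Cauchy's integral formula remains.\<close>

lemma cauchy_circle_measure:
  fixes h :: "complex \<Rightarrow> complex"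
  assumes [measurable]: "h \<in> borel_measurable borel"
    and cont: "continuous_on (cball 0 1) h" and hol: "h holomorphic_on ball 0 1" and a: "cmod a < 1"
  shows "integral\<^sup>L circle_measure (\<lambda>w. h w / (1 - a * cnj w)) = h a"
proof -
  have "((\<lambda>u. h u/(u-a)) has_contour_integral (2 * of_real pi * \<i> * h a)) (part_circlepath 0 1 0 (2*pi))"
    using Cauchy_integral_circlepath[OF cont hol] a unfolding circlepath_def by simp
  then have "((\<lambda>t. h (cis t) / (cis t - a) * \<i> * cis t) has_integral (2 * of_real pi * \<i> * h a)) {0..2*pi}"
    by (subst (asm) has_contour_integral_part_circlepath_iff) (simp_all add: mult.assoc)
  from has_integral_mult_right[OF this, of "-\<i>"]
  have "((\<lambda>t. h (cis t) * (cis t / (cis t - a))) has_integral (2 * of_real pi * h a)) {0..2*pi}"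
    by (simp add: algebra_simps)
  also have "(\<lambda>t. h (cis t) * (cis t / (cis t - a))) = (\<lambda>t. h (cis t) / (1 - a * cnj (cis t)))"
  proof
    fix t
    have "cis t \<noteq> a" using a by (metis norm_cis less_irrefl)
    moreover have "cis t * cnj (cis t) = 1"
      by (simp add: complex_norm_square[symmetric])
    moreover have "1 - a * cnj (cis t) \<noteq> 0"
      using a norm_mult[of a "cnj (cis t)"] by (auto simp: eq_iff_diff_eq_0[symmetric])
    ultimately show "h (cis t) * (cis t / (cis t - a)) = h (cis t) / (1 - a * cnj (cis t))"
      by (simp add: field_simps)
  qed
  finally have int: "((\<lambda>t. h (cis t) / (1 - a * cnj (cis t))) has_integral (2 * of_real pi * h a)) {0..2*pi}" .
  obtain B where B: "\<And>z. cmod z \<le> 1 \<Longrightarrow> cmod (h z) \<le> B"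
    using continuous_on_cball_bounded[OF cont] by blast
  have *: "cmod (h z / (1 - a * cnj z)) \<le> B / (1 - cmod a)" if "cmod z = 1" for z
  proof -
    have "cmod (1 - a * cnj z) \<ge> 1 - cmod a"
      using norm_triangle_ineq2[of 1 "a * cnj z"] that by (simp add: norm_mult)
    moreover have "0 \<le> B" using order_trans[OF norm_ge_zero B[of z]] that by simp
    ultimately show ?thesis
      unfolding norm_divide by (intro frac_le) (use B[of z] a that in auto)
  qed
  show ?thesis
    by (subst integral_circle_eq[OF _ int *]) auto
qed

lemma integrable_circle_bounded:
  fixes f :: "complex \<Rightarrow> 'a :: {banach, second_countable_topology}"
  assumes [measurable]: "f \<in> borel_measurable borel"
    and "\<And>z. cmod z = 1 \<Longrightarrow> norm (f z) \<le> B"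
  shows "integrable circle_measure f"
  using AE_circle by (intro circle.integrable_const_bound[where B=B]) (auto elim!: eventually_mono intro: assms)

lemma mean_value_circle_measure:
  assumes "h \<in> borel_measurable borel" "continuous_on (cball 0 1) h" "h holomorphic_on ball 0 1"
  shows "integral\<^sup>L circle_measure h = h 0"
  using cauchy_circle_measure[OF assms, of 0] by simp

section \<open>The Poisson kernel\<close>

text \<open>For \<open>cmod b = 1\<close> this is the classical Poisson kernel at \<open>a\<close>.
  The form with two points of the closed disc is the kernel at \<open>a * cnj b\<close>, which is
  what convolving two Poisson kernels produces.\<close>

definition poisson_kernel :: "complex \<Rightarrow> complex \<Rightarrow> real" where
  "poisson_kernel a b = (1 - (cmod a * cmod b)\<^sup>2) / (cmod (1 - cnj b * a))\<^sup>2"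

lemma measurable_poisson_kernel [measurable (raw)]:
  assumes [measurable]: "f \<in> borel_measurable M" "g \<in> borel_measurable M"
  shows "(\<lambda>x. poisson_kernel (f x) (g x)) \<in> borel_measurable M"
  unfolding poisson_kernel_def by measurable

lemma poisson_kernel_commute: "poisson_kernel a b = poisson_kernel b a"
proof -
  have "cmod (1 - cnj b * a) = cmod (cnj (1 - cnj b * a))"
    by (simp only: complex_mod_cnj)
  then show ?thesis
    by (simp add: poisson_kernel_def mult.commute)
qed

lemma poisson_kernel_nonneg: "cmod a \<le> 1 \<Longrightarrow> cmod b \<le> 1 \<Longrightarrow> 0 \<le> poisson_kernel a b"
  unfolding poisson_kernel_def
  by (intro divide_nonneg_nonneg) (auto intro!: power_le_one mult_le_one)

lemma poisson_kernel_le: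
  assumes "cmod a < 1" "cmod w = 1"
  shows "poisson_kernel a w \<le> 1 / (1 - cmod a)\<^sup>2"
proof -
  have "1 - cmod a \<le> cmod (1 - cnj w * a)"
    using norm_triangle_ineq2[of 1 "cnj w * a"] assms by (simp add: norm_mult)
  then show ?thesis
    unfolding poisson_kernel_def using assms by (intro frac_le power_mono) auto
qed

lemma Re_cayley: "Re ((1 + u) / (1 - u)) = (1 - (cmod u)\<^sup>2) / (cmod (1 - u))\<^sup>2"
  unfolding cmod_power2 Re_divide by (simp add: power2_eq_square algebra_simps)

text \<open>The factor \<open>(1 - |a|^2) / (1 - cnj a * w)\<close> is holomorphic near the closed
  disc and equals 1 at \<open>a\<close>. It turns the Cauchy kernel into the Poisson kernel, so
  Cauchy's formula for the product \<open>k\<close> is the claim.\<close>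

lemma poisson_formula:
  fixes h :: "complex \<Rightarrow> complex"
  assumes h [measurable]: "h \<in> borel_measurable borel"
    and cont: "continuous_on (cball 0 1) h" and hol: "h holomorphic_on ball 0 1" and a: "cmod a < 1"
  shows "(\<integral>w. complex_of_real (poisson_kernel a w) * h w \<partial>circle_measure) = h a"
proof -
  define k where "k = (\<lambda>w. h w * (1 - (cmod a)\<^sup>2) / (1 - cnj a * w))"
  have ne: "1 - cnj a * w \<noteq> 0" if "cmod w \<le> 1" for w
  proof
    assume "1 - cnj a * w = 0"
    then have "cnj a * w = 1" by simp
    then have "cmod a * cmod w = 1"
      by (metis complex_mod_cnj norm_mult norm_one)
    moreover have "cmod a * cmod w \<le> cmod a * 1"
      using that by (intro mult_left_mono) auto
    ultimately show False using a by simp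
  qed
  have "(\<integral>w. k w / (1 - a * cnj w) \<partial>circle_measure) = k a"
  proof (rule cauchy_circle_measure)
    show "k \<in> borel_measurable borel" unfolding k_def by measurable
    show "continuous_on (cball 0 1) k" unfolding k_def
      by (intro continuous_intros cont) (use ne in auto)
    show "k holomorphic_on ball 0 1" unfolding k_def
      by (intro holomorphic_intros hol) (use ne in auto)
  qed (fact a)
  moreover have "k a = h a"
  proof -
    have "cnj a * a = (cmod a)\<^sup>2"
      by (metis complex_norm_square mult.commute of_real_power)
    moreover have "1 - (cmod a)\<^sup>2 \<noteq> 0"
      using a power_less_one_iff[of "cmod a" 2] by simp
    moreover have "complex_of_real (1 - (cmod a)\<^sup>2) = 1 - complex_of_real ((cmod a)\<^sup>2)" by simp
    ultimately show ?thesis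
      unfolding k_def by (metis nonzero_mult_div_cancel_right of_real_eq_0_iff)
  qed
  moreover have "(\<integral>w. k w / (1 - a * cnj w) \<partial>circle_measure) =
      (\<integral>w. complex_of_real (poisson_kernel a w) * h w \<partial>circle_measure)"
  proof (rule integral_cong_AE)
    show "(\<lambda>w. k w / (1 - a * cnj w)) \<in> borel_measurable circle_measure"
      unfolding k_def by measurable
    show "(\<lambda>w. complex_of_real (poisson_kernel a w) * h w) \<in> borel_measurable circle_measure"
      by measurable
    show "AE w in circle_measure. k w / (1 - a * cnj w) = complex_of_real (poisson_kernel a w) * h w"
      using AE_circle
    proof eventually_elim
      fix w assume w: "cmod w = 1"
      have "(1 - cnj a * w) * (1 - a * cnj w) = (1 - cnj w * a) * cnj (1 - cnj w * a)"
        by (simp add: mult.commute)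
      also have "\<dots> = complex_of_real ((cmod (1 - cnj w * a))\<^sup>2)"
        by (simp only: complex_norm_square)
      finally show "k w / (1 - a * cnj w) = complex_of_real (poisson_kernel a w) * h w"
        unfolding k_def poisson_kernel_def using w by (simp add: divide_divide_eq_left)
    qed
  qed
  ultimately show ?thesis by simp
qed

lemma integrable_poisson_kernel_mult:
  fixes f :: "complex \<Rightarrow> 'a :: {banach, second_countable_topology}"
  assumes [measurable]: "f \<in> borel_measurable borel" and "cmod a < 1"
    and f: "\<And>z. cmod z = 1 \<Longrightarrow> norm (f z) \<le> B"
  shows "integrable circle_measure (\<lambda>w. poisson_kernel a w *\<^sub>R f w)"
proof (rule integrable_circle_bounded[where B = "1 / (1 - cmod a)\<^sup>2 * B"])
  fix z :: complex assume z: "cmod z = 1"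
  then show "norm (poisson_kernel a z *\<^sub>R f z) \<le> 1 / (1 - cmod a)\<^sup>2 * B"
    unfolding norm_scaleR
    using poisson_kernel_le[of a z] poisson_kernel_nonneg[of a z] assms(2) f[OF z]
    by (intro mult_mono) auto
qed simp

text \<open>As a function of \<open>w\<close>, the kernel at \<open>b\<close> is the real part of
  the Cayley type function \<open>h\<close>, holomorphic near the closed disc, so the Poisson
  formula for \<open>h\<close> at \<open>a\<close> gives the result.\<close>

lemma poisson_semigroup:
  assumes a: "cmod a < 1" and b: "cmod b < 1"
  shows "(\<integral>\<^sup>+w. ennreal (poisson_kernel a w) * ennreal (poisson_kernel b w) \<partial>circle_measure) =
    ennreal (poisson_kernel a b)"
proof -
  define h where "h = (\<lambda>w. (1 + cnj b * w) / (1 - cnj b * w))"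
  have [measurable]: "h \<in> borel_measurable borel" unfolding h_def by measurable
  have ne: "1 - cnj b * w \<noteq> 0" if "cmod w \<le> 1" for w
  proof
    assume "1 - cnj b * w = 0"
    then have "cnj b * w = 1" by simp
    then have "cmod b * cmod w = 1"
      by (metis complex_mod_cnj norm_mult norm_one)
    moreover have "cmod b * cmod w \<le> cmod b * 1"
      using that by (intro mult_left_mono) auto
    ultimately show False using b by simp
  qed
  have Re_h: "Re (h w) = poisson_kernel w b" for w
    unfolding h_def Re_cayley poisson_kernel_def by (simp add: norm_mult mult.commute)
  have cont: "continuous_on (cball 0 1) h" unfolding h_def
    by (intro continuous_intros) (use ne in auto)
  have hol: "h holomorphic_on ball 0 1" unfolding h_def
    by (intro holomorphic_intros) (use ne in auto)
  obtain B where B: "\<And>z. cmod z \<le> 1 \<Longrightarrow> cmod (h z) \<le> B"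
    using continuous_on_cball_bounded[OF cont] by blast
  have int: "integrable circle_measure (\<lambda>w. complex_of_real (poisson_kernel a w) * h w)"
    using integrable_poisson_kernel_mult[of h a B] a B by (simp add: scaleR_conv_of_real)
  have "(\<integral>w. poisson_kernel a w * poisson_kernel b w \<partial>circle_measure)
      = (\<integral>w. Re (complex_of_real (poisson_kernel a w) * h w) \<partial>circle_measure)"
    by (simp add: Re_h poisson_kernel_commute[of b])
  also have "\<dots> = Re (h a)"
    using poisson_formula[OF _ cont hol a] integral_Re[OF int] by simp
  finally have eq: "(\<integral>w. poisson_kernel a w * poisson_kernel b w \<partial>circle_measure) = poisson_kernel a b"
    by (simp add: Re_h)
  have nn: "AE w in circle_measure. 0 \<le> poisson_kernel a w \<and> 0 \<le> poisson_kernel b w"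
    using AE_circle by eventually_elim (use a b in \<open>auto intro!: poisson_kernel_nonneg\<close>)
  have "(\<integral>\<^sup>+w. ennreal (poisson_kernel a w) * ennreal (poisson_kernel b w) \<partial>circle_measure) =
     (\<integral>\<^sup>+w. ennreal (poisson_kernel a w * poisson_kernel b w) \<partial>circle_measure)"
    by (intro nn_integral_cong_AE, use nn in eventually_elim) (simp add: ennreal_mult)
  also have "\<dots> = ennreal (\<integral>w. poisson_kernel a w * poisson_kernel b w \<partial>circle_measure)"
  proof (rule nn_integral_eq_integral)
    show "integrable circle_measure (\<lambda>w. poisson_kernel a w * poisson_kernel b w)"
      using integrable_Re[OF int] by (simp add: Re_h poisson_kernel_commute[of b])
    show "AE w in circle_measure. 0 \<le> poisson_kernel a w * poisson_kernel b w"
      using nn by eventually_elim simp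
  qed
  finally show ?thesis using eq by simp
qed

text \<open>Moving the point with the larger radius \<open>s\<close> out to the circle costs a
  factor 2 in the numerator, because \<open>1 - r^4 \<le> 2 * (1 - r^2)\<close>, and a factor 2 in
  the distance, which is squared: \<open>8 = 2 * 4\<close>.\<close>

lemma poisson_kernel_compare_aux:
  assumes z: "cmod z = 1" "cmod z' = 1" and r: "0 \<le> r" "r \<le> s" "s < 1"
  shows "poisson_kernel (of_real r * z) (of_real s * z') \<le> 8 * poisson_kernel (of_real r * z) z'"
proof -
  define u where "u = cnj z' * z"
  have u: "cmod u = 1" by (simp add: u_def norm_mult z)
  have "cmod (1 - of_real r * u) \<le> cmod (1 - of_real (s * r) * u) + cmod (of_real (r * (1 - s)) * u)"
    by (rule order_trans[OF _ norm_triangle_ineq4]) (simp add: algebra_simps)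
  also have "cmod (of_real (r * (1 - s)) * u) = r * (1 - s)"
    using r u by (simp add: norm_mult del: of_real_mult of_real_diff)
  also have "r * (1 - s) \<le> 1 - s * r" using r by (simp add: algebra_simps)
  also have "1 - s * r \<le> cmod (1 - of_real (s * r) * u)"
    using norm_triangle_ineq2[of 1 "of_real (s * r) * u"] r u by (simp add: norm_mult)
  finally have le: "cmod (1 - of_real r * u) \<le> 2 * cmod (1 - of_real (s * r) * u)" by simp
  have pos: "0 < cmod (1 - of_real r * u)"
    using norm_triangle_ineq2[of 1 "of_real r * u"] r u by (auto simp: norm_mult simp del: zero_less_norm_iff)
  have "poisson_kernel (of_real r * z) (of_real s * z') = (1 - (r * s)\<^sup>2) / (cmod (1 - of_real (s * r) * u))\<^sup>2"
    using r z by (simp add: poisson_kernel_def norm_mult u_def mult_ac)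
  also have "\<dots> \<le> (2 * (1 - r\<^sup>2)) / ((cmod (1 - of_real r * u))\<^sup>2 / 4)"
  proof (rule frac_le)
    have "r * r \<le> r * s" using r by (intro mult_left_mono) auto
    then have "(r * r)\<^sup>2 \<le> (r * s)\<^sup>2" using r by (intro power_mono) auto
    moreover have "(1 - r\<^sup>2) * r\<^sup>2 \<le> (1 - r\<^sup>2) * 1"
      using r by (intro mult_left_mono) (auto simp: abs_square_le_1 power_le_one)
    ultimately show "1 - (r * s)\<^sup>2 \<le> 2 * (1 - r\<^sup>2)" by (simp add: algebra_simps power2_eq_square)
    show "(cmod (1 - of_real r * u))\<^sup>2 / 4 \<le> (cmod (1 - of_real (s * r) * u))\<^sup>2"
      using power_mono[OF le, of 2] by (simp add: power_mult_distrib)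
  qed (use r pos in \<open>auto simp: power_le_one\<close>)
  also have "\<dots> = 8 * poisson_kernel (of_real r * z) z'"
    using r z by (simp add: poisson_kernel_def norm_mult u_def mult_ac)
  finally show ?thesis .
qed

lemma poisson_kernel_compare:
  assumes z: "cmod z = 1" "cmod z' = 1" and r: "0 \<le> r" "r < 1" "0 \<le> s" "s < 1"
  shows "poisson_kernel (of_real r * z) (of_real s * z')
    \<le> 8 * (poisson_kernel (of_real r * z) z' + poisson_kernel (of_real s * z') z)"
proof -
  have "0 \<le> poisson_kernel (of_real r * z) z'" "0 \<le> poisson_kernel (of_real s * z') z"
    using z r by (auto intro!: poisson_kernel_nonneg simp: norm_mult)
  then show ?thesis
    using poisson_kernel_compare_aux[of z z' r s] poisson_kernel_compare_aux[of z' z s r] z r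
      poisson_kernel_commute[of "of_real r * z" "of_real s * z'"]
    by (cases "r \<le> s") (simp_all add: algebra_simps)
qed

section \<open>The radial maximal inequality\<close>

interpretation circle_pair: pair_sigma_finite circle_measure circle_measure ..

text \<open>
  A \<open>TT\<^sup>*\<close> argument. Let \<open>T\<close> be the integral of the kernels \<open>P(\<rho>(z)z, \<cdot>)\<close> over \<open>z \<in> E\<close> and \<open>B\<close> the
  square of its \<open>L\<^sup>2\<close> norm. The semigroup law turns \<open>B\<close> into a double integral of \<open>P(\<rho>(z)z, \<rho>(z')z')\<close>,
  and comparing kernels bounds this by \<open>16\<close> times the integral of \<open>T\<close> over \<open>E\<close>, so Cauchy--Schwarz
  gives \<open>B \<le> 256 \<mu>(E)\<close>.
\<close>

lemma radial_maximal_inequality: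
  fixes h :: "complex \<Rightarrow> complex" and \<rho> :: "complex \<Rightarrow> real"
  assumes h [measurable]: "h \<in> borel_measurable borel"
    and cont: "continuous_on (cball 0 1) h" and hol: "h holomorphic_on ball 0 1"
    and \<rho>_meas [measurable]: "\<rho> \<in> borel_measurable borel" and E [measurable]: "E \<in> sets borel"
    and \<rho>: "\<And>z. 0 \<le> \<rho> z" "\<And>z. \<rho> z \<le> R" and R: "R < 1" and lam: "0 \<le> lam"
    and large: "\<And>z. z \<in> E \<Longrightarrow> cmod z = 1 \<Longrightarrow> lam \<le> cmod (h (of_real (\<rho> z) * z))"
  shows "ennreal (lam\<^sup>2) * emeasure circle_measure E \<le> 256 * (\<integral>\<^sup>+w. ennreal ((cmod (h w))\<^sup>2) \<partial>circle_measure)"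
proof -
  let ?M = circle_measure
  define \<phi> where "\<phi> = (\<lambda>w z. indicator E z * ennreal (poisson_kernel (of_real (\<rho> z) * z) w))"
  define T where "T = (\<lambda>w. \<integral>\<^sup>+z. \<phi> w z \<partial>?M)"
  define B where "B = (\<integral>\<^sup>+w. T w ^ 2 \<partial>?M)"
  define H where "H = (\<integral>\<^sup>+w. ennreal ((cmod (h w))\<^sup>2) \<partial>?M)"
  have \<phi>_meas [measurable]: "(\<lambda>x. \<phi> (f x) (g x)) \<in> borel_measurable N"
    if [measurable]: "f \<in> borel_measurable N" "g \<in> borel_measurable N" for f g and N :: "'x measure"
    unfolding \<phi>_def by measurable
  have T_meas [measurable]: "T \<in> borel_measurable borel"
    unfolding T_def by measurable
  have cm: "cmod (of_real (\<rho> z) * z) < 1" if "cmod z = 1" for z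
    using \<rho>[of z] R that by (simp add: norm_mult)
  have "B = (\<integral>\<^sup>+w. \<integral>\<^sup>+z. \<integral>\<^sup>+z'. \<phi> w z * \<phi> w z' \<partial>?M \<partial>?M \<partial>?M)"
    unfolding B_def T_def power2_eq_square
    by (simp add: nn_integral_cmult nn_integral_multc)
  also have "\<dots> = (\<integral>\<^sup>+z. \<integral>\<^sup>+w. \<integral>\<^sup>+z'. \<phi> w z * \<phi> w z' \<partial>?M \<partial>?M \<partial>?M)"
    by (rule circle_pair.Fubini') measurable
  also have "\<dots> = (\<integral>\<^sup>+z. \<integral>\<^sup>+z'. \<integral>\<^sup>+w. \<phi> w z * \<phi> w z' \<partial>?M \<partial>?M \<partial>?M)"
    by (intro nn_integral_cong circle_pair.Fubini') measurable
  also have "\<dots> \<le> (\<integral>\<^sup>+z. \<integral>\<^sup>+z'. 8 * (indicator E z' * \<phi> z' z) + 8 * (indicator E z * \<phi> z z') \<partial>?M \<partial>?M)"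
  proof (intro nn_integral_mono_AE)
    show "AE z in ?M. (\<integral>\<^sup>+z'. \<integral>\<^sup>+w. \<phi> w z * \<phi> w z' \<partial>?M \<partial>?M) \<le>
        (\<integral>\<^sup>+z'. 8 * (indicator E z' * \<phi> z' z) + 8 * (indicator E z * \<phi> z z') \<partial>?M)"
      using AE_circle
    proof eventually_elim
      fix z :: complex assume z: "cmod z = 1"
      show "(\<integral>\<^sup>+z'. \<integral>\<^sup>+w. \<phi> w z * \<phi> w z' \<partial>?M \<partial>?M) \<le>
        (\<integral>\<^sup>+z'. 8 * (indicator E z' * \<phi> z' z) + 8 * (indicator E z * \<phi> z z') \<partial>?M)"
      proof (rule nn_integral_mono_AE)
        show "AE z' in ?M. (\<integral>\<^sup>+w. \<phi> w z * \<phi> w z' \<partial>?M) \<le>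
            8 * (indicator E z' * \<phi> z' z) + 8 * (indicator E z * \<phi> z z')"
          using AE_circle
        proof eventually_elim
          fix z' :: complex assume z': "cmod z' = 1"
          let ?a = "of_real (\<rho> z) * z" and ?b = "of_real (\<rho> z') * z'"
          have "(\<integral>\<^sup>+w. \<phi> w z * \<phi> w z' \<partial>?M) =
              (\<integral>\<^sup>+w. (indicator E z * indicator E z') * (ennreal (poisson_kernel ?a w) * ennreal (poisson_kernel ?b w)) \<partial>?M)"
            unfolding \<phi>_def by (simp add: mult_ac)
          also have "\<dots> = (indicator E z * indicator E z') * ennreal (poisson_kernel ?a ?b)"
            by (simp add: nn_integral_cmult poisson_semigroup cm z z')
          also have "\<dots> \<le> (indicator E z * indicator E z') * ennreal (8 * (poisson_kernel ?a z' + poisson_kernel ?b z))"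
            using \<rho>[of z] \<rho>[of z'] R by (intro mult_left_mono ennreal_leI poisson_kernel_compare z z') auto
          also have "\<dots> = 8 * (indicator E z' * \<phi> z' z) + 8 * (indicator E z * \<phi> z z')"
            unfolding \<phi>_def using poisson_kernel_nonneg[of ?a z'] poisson_kernel_nonneg[of ?b z] cm[OF z] cm[OF z'] z z'
            by (simp add: ennreal_mult ennreal_plus distrib_left mult_ac split: split_indicator)
          finally show "(\<integral>\<^sup>+w. \<phi> w z * \<phi> w z' \<partial>?M) \<le>
            8 * (indicator E z' * \<phi> z' z) + 8 * (indicator E z * \<phi> z z')" .
        qed
      qed
    qed
  qed
  also have "\<dots> = (\<integral>\<^sup>+z. \<integral>\<^sup>+z'. 8 * (indicator E z' * \<phi> z' z) \<partial>?M \<partial>?M) + (\<integral>\<^sup>+z. \<integral>\<^sup>+z'. 8 * (indicator E z * \<phi> z z') \<partial>?M \<partial>?M)"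
    by (simp add: nn_integral_add)
  also have "(\<integral>\<^sup>+z. \<integral>\<^sup>+z'. 8 * (indicator E z' * \<phi> z' z) \<partial>?M \<partial>?M) = (\<integral>\<^sup>+z'. \<integral>\<^sup>+z. 8 * (indicator E z' * \<phi> z' z) \<partial>?M \<partial>?M)"
    by (rule circle_pair.Fubini') measurable
  finally have "B \<le> 8 * (\<integral>\<^sup>+z. indicator E z * T z \<partial>?M) + 8 * (\<integral>\<^sup>+z. indicator E z * T z \<partial>?M)"
    by (simp add: nn_integral_cmult T_def)
  then have B_le: "B \<le> 16 * (\<integral>\<^sup>+z. indicator E z * T z \<partial>?M)"
    by (simp add: distrib_right[symmetric])
  have ind2: "(\<integral>\<^sup>+z. indicator E z ^ 2 \<partial>?M) = emeasure ?M E"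
  proof -
    have "(\<lambda>z. indicator E z ^ 2 :: ennreal) = indicator E" by (auto simp: fun_eq_iff split: split_indicator)
    then show ?thesis by simp
  qed
  have "B\<^sup>2 \<le> (16 * (\<integral>\<^sup>+z. indicator E z * T z \<partial>?M))\<^sup>2"
    by (intro power_mono B_le) simp
  also have "\<dots> = 256 * (\<integral>\<^sup>+z. indicator E z * T z \<partial>?M)\<^sup>2"
    by (simp add: power_mult_distrib)
  also have "\<dots> \<le> 256 * (emeasure ?M E * B)"
    using Cauchy_Schwarz_nn_integral[of "indicator E" ?M T]
    by (intro mult_left_mono) (auto simp: ind2 B_def)
  finally have "B * B \<le> B * (256 * emeasure ?M E)"
    by (simp add: power2_eq_square mult_ac)
  \<comment> \<open>Finiteness allows cancelling \<open>B\<close>. It comes from the radii staying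
    below \<open>R < 1\<close>, which bounds all the kernels; this bound does not enter the final
    constant.\<close>
  moreover have "B < top"
  proof -
    have T_le: "T w \<le> ennreal (1 / (1 - R)\<^sup>2)" if w: "cmod w = 1" for w
    proof -
      have "T w \<le> (\<integral>\<^sup>+z. ennreal (1 / (1 - R)\<^sup>2) \<partial>?M)"
        unfolding T_def
      proof (rule nn_integral_mono_AE)
        show "AE z in ?M. \<phi> w z \<le> ennreal (1 / (1 - R)\<^sup>2)"
          using AE_circle
        proof eventually_elim
          fix z :: complex assume z: "cmod z = 1"
          have "poisson_kernel (of_real (\<rho> z) * z) w \<le> 1 / (1 - cmod (of_real (\<rho> z) * z))\<^sup>2"
            by (rule poisson_kernel_le[OF cm[OF z] w])
          also have "\<dots> \<le> 1 / (1 - R)\<^sup>2"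
            using \<rho>[of z] R z by (intro divide_left_mono power_mono mult_pos_pos) (auto simp: norm_mult)
          finally show "\<phi> w z \<le> ennreal (1 / (1 - R)\<^sup>2)"
            unfolding \<phi>_def by (auto split: split_indicator intro!: ennreal_leI)
        qed
      qed
      then show ?thesis by (simp add: circle.emeasure_space_1[simplified])
    qed
    have "B \<le> (\<integral>\<^sup>+w. ennreal (1 / (1 - R)\<^sup>2) ^ 2 \<partial>?M)"
      unfolding B_def by (intro nn_integral_mono_AE, use AE_circle in eventually_elim) (auto intro!: power_mono T_le)
    also have "\<dots> = ennreal (1 / (1 - R)\<^sup>2) ^ 2"
      by (simp add: circle.emeasure_space_1[simplified])
    also have "\<dots> < top" by (simp add: power_less_top_ennreal)
    finally show ?thesis .
  qed
  ultimately have B256: "B \<le> 256 * emeasure ?M E"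
    by (cases "B = 0") (auto simp: ennreal_mult_le_mult_iff)
  \<comment> \<open>Poisson's formula at \<open>\<rho> z * z\<close>, integrated over
    \<open>E\<close>, turns the lower bound for \<open>h\<close> into a pairing of
    \<open>cmod (h w)\<close> with \<open>T\<close>. Cauchy-Schwarz and the bound on
    \<open>B\<close> then leave one factor of the measure of \<open>E\<close> to cancel.\<close>
  have "ennreal lam * emeasure ?M E = (\<integral>\<^sup>+z. ennreal lam * indicator E z \<partial>?M)"
    by (simp add: nn_integral_cmult_indicator)
  also have "\<dots> \<le> (\<integral>\<^sup>+z. \<integral>\<^sup>+w. \<phi> w z * ennreal (cmod (h w)) \<partial>?M \<partial>?M)"
  proof (rule nn_integral_mono_AE)
    show "AE z in ?M. ennreal lam * indicator E z \<le> (\<integral>\<^sup>+w. \<phi> w z * ennreal (cmod (h w)) \<partial>?M)"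
      using AE_circle
    proof eventually_elim
      fix z :: complex assume z: "cmod z = 1"
      let ?a = "of_real (\<rho> z) * z"
      show "ennreal lam * indicator E z \<le> (\<integral>\<^sup>+w. \<phi> w z * ennreal (cmod (h w)) \<partial>?M)"
      proof (cases "z \<in> E")
        case True
        have "lam \<le> cmod (h ?a)" by (rule large[OF True z])
        also have "h ?a = (\<integral>w. complex_of_real (poisson_kernel ?a w) * h w \<partial>?M)"
          by (rule poisson_formula[OF h cont hol cm[OF z], symmetric])
        finally have "ennreal lam \<le> ennreal (cmod (\<integral>w. complex_of_real (poisson_kernel ?a w) * h w \<partial>?M))"
          by (rule ennreal_leI)
        also have "\<dots> \<le> (\<integral>\<^sup>+w. ennreal (cmod (complex_of_real (poisson_kernel ?a w) * h w)) \<partial>?M)"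
          by (rule integral_norm_bound_ennreal)
            (use integrable_poisson_kernel_mult[OF h cm[OF z]] continuous_on_cball_bounded[OF cont] in
              \<open>metis (no_types, lifting) Bochner_Integration.integrable_cong order_refl scaleR_conv_of_real\<close>)
        also have "\<dots> = (\<integral>\<^sup>+w. \<phi> w z * ennreal (cmod (h w)) \<partial>?M)"
        proof (rule nn_integral_cong_AE, use AE_circle in eventually_elim)
          fix w :: complex assume w: "cmod w = 1"
          have "0 \<le> poisson_kernel ?a w"
            using cm[OF z] w by (intro poisson_kernel_nonneg) auto
          then show "ennreal (cmod (complex_of_real (poisson_kernel ?a w) * h w)) = \<phi> w z * ennreal (cmod (h w))"
            unfolding \<phi>_def using True by (simp add: norm_mult ennreal_mult)
        qed
        finally show ?thesis using True by simp
      qed simp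
    qed
  qed
  also have "\<dots> = (\<integral>\<^sup>+w. \<integral>\<^sup>+z. \<phi> w z * ennreal (cmod (h w)) \<partial>?M \<partial>?M)"
    by (rule circle_pair.Fubini') measurable
  also have "\<dots> = (\<integral>\<^sup>+w. ennreal (cmod (h w)) * T w \<partial>?M)"
    by (simp add: nn_integral_multc T_def mult.commute)
  finally have "(ennreal lam * emeasure ?M E)\<^sup>2 \<le> (\<integral>\<^sup>+w. ennreal (cmod (h w)) * T w \<partial>?M)\<^sup>2"
    by (intro power_mono) auto
  also have "\<dots> \<le> (\<integral>\<^sup>+w. ennreal (cmod (h w)) ^ 2 \<partial>?M) * B"
    unfolding B_def by (rule Cauchy_Schwarz_nn_integral) measurable
  also have "(\<integral>\<^sup>+w. ennreal (cmod (h w)) ^ 2 \<partial>?M) = H"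
    unfolding H_def by (simp add: ennreal_power)
  also have "H * B \<le> H * (256 * emeasure ?M E)"
    by (intro mult_left_mono B256) simp
  finally have "emeasure ?M E * (ennreal (lam\<^sup>2) * emeasure ?M E) \<le> emeasure ?M E * (256 * H)"
    using lam by (simp add: power2_eq_square mult_ac ennreal_mult)
  then show ?thesis
    unfolding H_def[symmetric]
    by (cases "emeasure ?M E = 0") (auto simp: ennreal_mult_le_mult_iff circle.emeasure_eq_measure)
qed

section \<open>Orthogonality of the monomials and Parseval's identity\<close>

lemma integral_power_cnj_power:
  "(\<integral>z. z ^ m * cnj (z ^ n) \<partial>circle_measure) = (if m = n then 1 else 0)"
proof -
  have ge: "(\<integral>z. z ^ m * cnj (z ^ n) \<partial>circle_measure) = (if m = n then 1 else 0)" if "n \<le> m" for m n :: nat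
  proof -
    have "(\<integral>z. z ^ m * cnj (z ^ n) \<partial>circle_measure) = (\<integral>z. z ^ (m - n) \<partial>circle_measure)"
    proof (rule integral_cong_AE)
      show "AE z in circle_measure. z ^ m * cnj (z ^ n) = z ^ (m - n)"
        using AE_circle
      proof eventually_elim
        fix z :: complex assume "cmod z = 1"
        then have "z ^ n * cnj (z ^ n) = 1"
          by (simp add: complex_norm_square[symmetric] norm_power del: complex_cnj_power)
        moreover have "z ^ m = z ^ (m - n) * z ^ n" using that by (simp add: power_add[symmetric])
        ultimately show "z ^ m * cnj (z ^ n) = z ^ (m - n)"
          by (simp add: mult.assoc del: complex_cnj_power)
      qed
    qed measurable
    also have "\<dots> = 0 ^ (m - n)"
      by (rule mean_value_circle_measure) (auto intro!: continuous_intros holomorphic_intros borel_measurable_continuous_onI)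
    finally show ?thesis using that by (auto simp: power_0_left)
  qed
  show ?thesis
  proof (cases "n \<le> m")
    case False
    have "(\<integral>z. z ^ m * cnj (z ^ n) \<partial>circle_measure) = (\<integral>z. cnj (z ^ n * cnj (z ^ m)) \<partial>circle_measure)"
      by (simp add: mult.commute)
    also have "\<dots> = cnj (if n = m then 1 else 0)"
      unfolding Bochner_Integration.integral_cnj using ge[of m n] False by simp
    finally show ?thesis by auto
  qed (rule ge)
qed

lemma parseval_finite:
  fixes c :: "nat \<Rightarrow> complex"
  shows "(\<integral>z. (cmod (\<Sum>n<N. c n * z ^ n))\<^sup>2 \<partial>circle_measure) = (\<Sum>n<N. (cmod (c n))\<^sup>2)"
proof -
  have int: "integrable circle_measure (\<lambda>z. c m * z ^ m * cnj (c n * z ^ n))" for m n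
    by (rule integrable_circle_bounded[where B = "cmod (c m) * cmod (c n)"]) (auto simp: norm_mult norm_power)
  have "complex_of_real (\<integral>z. (cmod (\<Sum>n<N. c n * z ^ n))\<^sup>2 \<partial>circle_measure)
      = (\<integral>z. complex_of_real ((cmod (\<Sum>n<N. c n * z ^ n))\<^sup>2) \<partial>circle_measure)"
    by (rule integral_complex_of_real[symmetric])
  also have "\<dots> = (\<integral>z. (\<Sum>m<N. \<Sum>n<N. c m * z ^ m * cnj (c n * z ^ n)) \<partial>circle_measure)"
    by (simp only: complex_norm_square cnj_sum sum_product)
  also have "\<dots> = (\<Sum>m<N. \<Sum>n<N. \<integral>z. c m * z ^ m * cnj (c n * z ^ n) \<partial>circle_measure)"
    using int by (simp add: Bochner_Integration.integral_sum)
  also have "\<dots> = (\<Sum>m<N. \<Sum>n<N. c m * cnj (c n) * (\<integral>z. z ^ m * cnj (z ^ n) \<partial>circle_measure))"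
    by (intro sum.cong refl, subst integral_mult_right_zero[symmetric]) (simp add: mult_ac)
  also have "\<dots> = (\<Sum>m<N. complex_of_real ((cmod (c m))\<^sup>2))"
    unfolding integral_power_cnj_power complex_norm_square
    by (intro sum.cong refl) (simp add: if_distrib sum.delta cong: if_cong)
  finally show ?thesis
    by (metis of_real_eq_iff of_real_sum)
qed

lemma parseval_power_series:
  fixes c :: "nat \<Rightarrow> complex"
  assumes c: "summable (\<lambda>n. cmod (c n))" and F [measurable]: "F \<in> borel_measurable borel"
    and F_eq: "\<And>z. cmod z = 1 \<Longrightarrow> (\<lambda>n. c n * z ^ n) sums F z"
  shows "(\<lambda>n. (cmod (c n))\<^sup>2) sums (\<integral>z. (cmod (F z))\<^sup>2 \<partial>circle_measure)"
proof -
  let ?C = "\<Sum>n. cmod (c n)"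
  have "(\<lambda>N. \<integral>z. (cmod (\<Sum>n<N. c n * z ^ n))\<^sup>2 \<partial>circle_measure) \<longlonglongrightarrow> (\<integral>z. (cmod (F z))\<^sup>2 \<partial>circle_measure)"
  proof (rule integral_dominated_convergence[where w = "\<lambda>_. ?C\<^sup>2"])
    show "AE z in circle_measure. (\<lambda>N. (cmod (\<Sum>n<N. c n * z ^ n))\<^sup>2) \<longlonglongrightarrow> (cmod (F z))\<^sup>2"
      using AE_circle
      by eventually_elim (use F_eq in \<open>auto simp: sums_def intro!: tendsto_intros\<close>)
    show "AE z in circle_measure. norm ((cmod (\<Sum>n<N. c n * z ^ n))\<^sup>2) \<le> ?C\<^sup>2" for N
      using AE_circle
    proof eventually_elim
      fix z :: complex assume z: "cmod z = 1"
      have "cmod (\<Sum>n<N. c n * z ^ n) \<le> (\<Sum>n<N. cmod (c n * z ^ n))" by (rule norm_sum)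
      also have "\<dots> = (\<Sum>n<N. cmod (c n))" using z by (simp add: norm_mult norm_power)
      also have "\<dots> \<le> ?C" by (rule sum_le_suminf[OF c]) auto
      finally show "norm ((cmod (\<Sum>n<N. c n * z ^ n))\<^sup>2) \<le> ?C\<^sup>2"
        by (simp add: power_mono)
    qed
  qed auto
  then show ?thesis
    by (simp add: parseval_finite sums_def)
qed

section \<open>Fatou's theorem on radial limits\<close>

text \<open>A Cauchy criterion in which the comparison value may depend on \<open>e\<close>; in
  Fatou's theorem it is the value of a Taylor polynomial at the boundary point.\<close>

lemma tendsto_if_nearly_constant:
  fixes F :: "'a \<Rightarrow> 'b :: {real_normed_vector, complete_space}"
  assumes G: "G \<noteq> bot"
    and near: "\<And>e. e > 0 \<Longrightarrow> \<exists>c. \<forall>\<^sub>F r in G. norm (F r - c) \<le> e"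
  shows "\<exists>l. (F \<longlongrightarrow> l) G"
proof -
  have "\<forall>n::nat. \<exists>c. \<forall>\<^sub>F r in G. norm (F r - c) \<le> 1 / (real n + 1)"
    by (intro allI near) simp
  from choice[OF this]
  obtain c where c: "\<And>n::nat. \<forall>\<^sub>F r in G. norm (F r - c n) \<le> 1 / (real n + 1)"
    by blast
  have cd: "norm (c m - c n) \<le> 1 / (real m + 1) + 1 / (real n + 1)" for m n
  proof -
    have "\<forall>\<^sub>F r in G. norm (c m - c n) \<le> 1 / (real m + 1) + 1 / (real n + 1)"
      using c[of m] c[of n]
    proof eventually_elim
      case (elim r)
      have "norm (c m - c n) \<le> norm (F r - c n) + norm (F r - c m)"
        using norm_triangle_ineq4[of "F r - c n" "F r - c m"] by simp
      with elim show ?case by simp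
    qed
    then show ?thesis using G by (simp add: eventually_const)
  qed
  have "Cauchy c"
  proof (rule metric_CauchyI)
    fix e :: real assume e: "e > 0"
    then obtain N where N: "1 / (real N + 1) < e / 2"
      using nat_approx_posE[of "e / 2"] by (auto simp: add.commute)
    have "dist (c m) (c n) < e" if "m \<ge> N" "n \<ge> N" for m n
    proof -
      have "1 / (real m + 1) \<le> 1 / (real N + 1)" "1 / (real n + 1) \<le> 1 / (real N + 1)"
        using that by (auto intro!: divide_left_mono)
      with N cd[of m n] show ?thesis by (simp add: dist_norm)
    qed
    then show "\<exists>M. \<forall>m\<ge>M. \<forall>n\<ge>M. dist (c m) (c n) < e" by blast
  qed
  then obtain l where l: "c \<longlonglongrightarrow> l"
    using convergent_eq_Cauchy by blast
  have "(F \<longlongrightarrow> l) G"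
  proof (rule tendstoI)
    fix e :: real assume e: "e > 0"
    have "(\<lambda>n. 1 / (real n + 1)) \<longlonglongrightarrow> 0"
      using LIMSEQ_inverse_real_of_nat by (simp add: inverse_eq_divide add.commute)
    from order_tendstoD(2)[OF this, of "e / 2"] tendstoD[OF l, of "e / 2"] e
    have "\<forall>\<^sub>F n in sequentially. 1 / (real n + 1) < e / 2 \<and> dist (c n) l < e / 2"
      by (auto intro: eventually_conj)
    then obtain n where n: "1 / (real n + 1) < e / 2" "dist (c n) l < e / 2"
      unfolding eventually_sequentially by blast
    show "\<forall>\<^sub>F r in G. dist (F r) l < e"
      using c[of n]
    proof eventually_elim
      case (elim r)
      then have "dist (F r) (c n) < e / 2" using n by (simp add: dist_norm)
      then show ?case using n(2) dist_triangle[of "F r" l "c n"] by simp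
    qed
  qed
  then show ?thesis ..
qed

lemma scaled_lt_one: "0 \<le> r \<Longrightarrow> r < 1 \<Longrightarrow> x \<le> 1 \<Longrightarrow> r * x < (1::real)"
  using mult_left_le[of x r] by simp

locale bounded_disc_function =
  fixes f :: "complex \<Rightarrow> complex" and M :: real
  assumes hol: "f holomorphic_on ball 0 1" and bnd: "\<And>z. cmod z < 1 \<Longrightarrow> cmod (f z) \<le> M"
begin

definition coef :: "nat \<Rightarrow> complex" where
  "coef n = (deriv ^^ n) f 0 / fact n"

text \<open>The Taylor remainder, put to zero off the disc so that it is Borel on the whole plane.
  Inside the disc \<open>tail_fun 0\<close> is \<open>f\<close> itself.\<close>

definition tail_fun :: "nat \<Rightarrow> complex \<Rightarrow> complex" where
  "tail_fun N w = (if w \<in> ball 0 1 then f w - (\<Sum>n<N. coef n * w ^ n) else 0)"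

lemma coef_sums: "cmod w < 1 \<Longrightarrow> (\<lambda>n. coef n * w ^ n) sums f w"
  using holomorphic_power_series[OF hol, of w] by (simp add: coef_def)

lemma coef_abs_summable:
  assumes "0 \<le> r" "r < 1"
  shows "summable (\<lambda>n. cmod (coef n * of_real r ^ n))"
proof -
  have "summable (\<lambda>n. coef n * of_real ((1 + r) / 2) ^ n)"
    by (rule sums_summable[OF coef_sums]) (use assms in \<open>simp only: norm_of_real, simp\<close>)
  then show ?thesis
    by (rule powser_insidea) (use assms in \<open>simp only: norm_of_real, simp\<close>)
qed

lemma measurable_tail_fun [measurable]: "tail_fun N \<in> borel_measurable borel"
  unfolding tail_fun_def
  by (rule borel_measurable_continuous_on_if)
    (auto intro!: continuous_intros holomorphic_on_imp_continuous_on[OF hol])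

lemma holomorphic_tail_fun: "tail_fun N holomorphic_on ball 0 1"
  by (rule holomorphic_transform[where f = "\<lambda>w. f w - (\<Sum>n<N. coef n * w ^ n)"])
    (auto intro!: holomorphic_intros hol simp: tail_fun_def)

lemma parseval_tail:
  assumes r: "0 < r" "r < 1"
  shows "(\<lambda>n. if n < N then 0 else (cmod (coef n) * r ^ n)\<^sup>2) sums
    (\<integral>z. (cmod (tail_fun N (of_real r * z)))\<^sup>2 \<partial>circle_measure)"
proof -
  define c where "c = (\<lambda>n. if n < N then 0 else coef n * of_real r ^ n)"
  have "(\<lambda>n. (cmod (c n))\<^sup>2) sums (\<integral>z. (cmod (tail_fun N (of_real r * z)))\<^sup>2 \<partial>circle_measure)"
  proof (rule parseval_power_series)
    show "summable (\<lambda>n. cmod (c n))"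
      by (rule summable_comparison_test[OF _ coef_abs_summable[of r]]) (use r in \<open>auto simp: c_def\<close>)
    show "(\<lambda>z. tail_fun N (of_real r * z)) \<in> borel_measurable borel" by measurable
    fix z :: complex assume z: "cmod z = 1"
    then have rz: "cmod (of_real r * z) < 1" using r by (simp add: norm_mult)
    have "(\<lambda>n. coef n * (of_real r * z) ^ n - (if n < N then coef n * (of_real r * z) ^ n else 0))
        sums (f (of_real r * z) - (\<Sum>n<N. coef n * (of_real r * z) ^ n))"
    proof (rule sums_diff[OF coef_sums[OF rz]])
      show "(\<lambda>n. if n < N then coef n * (of_real r * z) ^ n else 0) sums (\<Sum>n<N. coef n * (of_real r * z) ^ n)"
        using sums_If_finite_set[of "{..<N}" "\<lambda>n. coef n * (of_real r * z) ^ n"] by simp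
    qed
    also have "(\<lambda>n. coef n * (of_real r * z) ^ n - (if n < N then coef n * (of_real r * z) ^ n else 0))
        = (\<lambda>n. c n * z ^ n)"
      by (auto simp: c_def fun_eq_iff power_mult_distrib)
    also have "f (of_real r * z) - (\<Sum>n<N. coef n * (of_real r * z) ^ n) = tail_fun N (of_real r * z)"
      using rz by (simp add: tail_fun_def)
    finally show "(\<lambda>n. c n * z ^ n) sums tail_fun N (of_real r * z)" .
  qed
  also have "(\<lambda>n. (cmod (c n))\<^sup>2) = (\<lambda>n. if n < N then 0 else (cmod (coef n) * r ^ n)\<^sup>2)"
    using r by (auto simp: c_def fun_eq_iff norm_mult norm_power)
  finally show ?thesis .
qed

text \<open>Parseval on the circle of radius \<open>r\<close> bounds every partial sum by
  \<open>M^2\<close>; then \<open>r\<close> tends to 1.\<close>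

lemma coef_square_summable: "summable (\<lambda>n. (cmod (coef n))\<^sup>2)"
proof (rule summableI_nonneg_bounded)
  fix N
  have "(\<Sum>n<N. (cmod (coef n) * r ^ n)\<^sup>2) \<le> M\<^sup>2" if r: "0 < r" "r < 1" for r
  proof -
    have s: "summable (\<lambda>n. (cmod (coef n) * r ^ n)\<^sup>2)"
      and eq: "(\<Sum>n. (cmod (coef n) * r ^ n)\<^sup>2) = (\<integral>z. (cmod (tail_fun 0 (of_real r * z)))\<^sup>2 \<partial>circle_measure)"
      using parseval_tail[OF r, of 0] by (auto simp: sums_iff)
    have "(\<Sum>n<N. (cmod (coef n) * r ^ n)\<^sup>2) \<le> (\<integral>z. (cmod (tail_fun 0 (of_real r * z)))\<^sup>2 \<partial>circle_measure)"
      unfolding eq[symmetric] by (rule sum_le_suminf[OF s]) auto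
    also have "\<dots> \<le> M\<^sup>2"
    proof (rule circle.integral_le_const)
      have *: "(cmod (tail_fun 0 (of_real r * z)))\<^sup>2 \<le> M\<^sup>2" if "cmod z = 1" for z
        using bnd[of "of_real r * z"] r that by (simp add: tail_fun_def norm_mult power_mono)
      show "integrable circle_measure (\<lambda>z. (cmod (tail_fun 0 (of_real r * z)))\<^sup>2)"
        by (rule integrable_circle_bounded[where B = "M\<^sup>2"]) (use * in auto)
      show "AE z in circle_measure. (cmod (tail_fun 0 (of_real r * z)))\<^sup>2 \<le> M\<^sup>2"
        using AE_circle by eventually_elim (rule *)
    qed
    finally show ?thesis .
  qed
  then have "\<forall>\<^sub>F r in at_left (1::real). (\<Sum>n<N. (cmod (coef n) * r ^ n)\<^sup>2) \<le> M\<^sup>2"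
    using eventually_at_left_real[of 0 1] by (auto elim!: eventually_mono)
  moreover have "((\<lambda>r. \<Sum>n<N. (cmod (coef n) * r ^ n)\<^sup>2) \<longlongrightarrow> (\<Sum>n<N. (cmod (coef n) * 1 ^ n)\<^sup>2)) (at_left (1::real))"
    by (intro tendsto_intros)
  ultimately show "(\<Sum>n<N. (cmod (coef n))\<^sup>2) \<le> M\<^sup>2"
    using tendsto_upperbound by force
qed simp

definition tail_norm :: "nat \<Rightarrow> real" where
  "tail_norm N = (\<Sum>n. (cmod (coef (n + N)))\<^sup>2)"

lemma tail_norm_tendsto: "tail_norm \<longlonglongrightarrow> 0"
  unfolding tail_norm_def by (rule suminf_exist_split2[OF coef_square_summable])

lemma tail_fun_L2_le:
  assumes r: "0 < r" "r < 1"
  shows "(\<integral>\<^sup>+z. ennreal ((cmod (tail_fun N (of_real r * z)))\<^sup>2) \<partial>circle_measure) \<le> ennreal (tail_norm N)"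
proof -
  let ?g = "\<lambda>n. if n < N then 0 else (cmod (coef n) * r ^ n)\<^sup>2"
  have "continuous_on (cball 0 1) (\<lambda>z. tail_fun N (of_real r * z))"
    by (rule continuous_on_compose2[OF holomorphic_on_imp_continuous_on[OF holomorphic_tail_fun]])
      (use r in \<open>auto intro!: continuous_intros simp: norm_mult scaled_lt_one\<close>)
  then obtain B where B: "\<And>z. cmod z \<le> 1 \<Longrightarrow> cmod (tail_fun N (of_real r * z)) \<le> B"
    using continuous_on_cball_bounded by blast
  have int: "integrable circle_measure (\<lambda>z. (cmod (tail_fun N (of_real r * z)))\<^sup>2)"
    by (rule integrable_circle_bounded[where B = "B\<^sup>2"]) (use B in \<open>auto intro!: power_mono\<close>)
  have g: "summable ?g" "(\<integral>z. (cmod (tail_fun N (of_real r * z)))\<^sup>2 \<partial>circle_measure) = suminf ?g"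
    using parseval_tail[OF r, of N] by (auto simp: sums_iff)
  have "suminf ?g = (\<Sum>n. ?g (n + N))"
    using suminf_split_initial_segment[OF g(1), of N] by simp
  also have "\<dots> \<le> tail_norm N"
    unfolding tail_norm_def
  proof (rule suminf_le)
    show "?g (n + N) \<le> (cmod (coef (n + N)))\<^sup>2" for n
      using r by (auto intro!: power_mono mult_left_le power_le_one)
    show "summable (\<lambda>n. ?g (n + N))" using g(1) by (rule summable_ignore_initial_segment)
    show "summable (\<lambda>n. (cmod (coef (n + N)))\<^sup>2)"
      using coef_square_summable by (rule summable_ignore_initial_segment)
  qed
  finally show ?thesis
    using nn_integral_eq_integral[OF int] g(2) by (simp add: ennreal_leI)
qed

text \<open>The maximal function over finitely many radii is linearised: on the bad set a measurable
  choice of radius makes the tail large, which is the situation of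
  \<open>radial_maximal_inequality\<close>. The bound does not depend on \<open>n\<close>, so all
  rational radii can be reached later.\<close>

lemma tail_fun_weak_type_finite:
  fixes q :: "nat \<Rightarrow> real" and n N :: nat
  assumes q: "\<And>i. 0 < q i" "\<And>i. q i < 1" and lam: "0 < lam"
  defines "E \<equiv> {z. cmod z = 1 \<and> (\<exists>i<n. lam < cmod (tail_fun N (of_real (q i) * z)))}"
  shows "ennreal (lam\<^sup>2) * emeasure circle_measure E \<le> 256 * ennreal (tail_norm N)" and "E \<in> sets borel"
proof -
  show E [measurable]: "E \<in> sets borel" unfolding E_def by measurable
  define R0 where "R0 = Max (insert (1/2) (q ` {..<n}))"
  have R0: "q i \<le> R0" if "i < n" for i unfolding R0_def using that by (intro Max_ge) auto
  have R0': "1/2 \<le> R0" unfolding R0_def by (rule Max_ge) auto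
  have R0'': "R0 < 1" unfolding R0_def using q by (subst Max_less_iff) auto
  \<comment> \<open>A radius strictly between the largest \<open>q i\<close> and 1: dilating by
    \<open>R\<close> makes the tail continuous up to the circle, and the rescaled radii
    \<open>q i / R\<close> still stay below \<open>R0 / R < 1\<close>. The \<open>1/2\<close> in
    \<open>R0\<close> only keeps the maximum nonempty and positive.\<close>
  define R where "R = (1 + R0) / 2"
  have R: "0 < R" "R < 1" "R0 < R" using R0' R0'' by (auto simp: R_def)
  \<comment> \<open>Choosing the first bad index makes the selection measurable.\<close>
  define L where "L = (\<lambda>z. LEAST i. lam < cmod (tail_fun N (of_real (q i) * z)))"
  have L: "L z < n" "lam < cmod (tail_fun N (of_real (q (L z)) * z))" if "z \<in> E" for z
  proof -
    obtain i where i: "i < n" "lam < cmod (tail_fun N (of_real (q i) * z))" using \<open>z \<in> E\<close> unfolding E_def by blast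
    show "lam < cmod (tail_fun N (of_real (q (L z)) * z))" unfolding L_def using i(2) by (rule LeastI)
    show "L z < n" 
      unfolding L_def using Least_le[of "\<lambda>i. lam < cmod (tail_fun N (of_real (q i) * z))" i] i by simp
  qed
  have [measurable]: "L \<in> borel \<rightarrow>\<^sub>M count_space UNIV" unfolding L_def by measurable
  define \<rho> where "\<rho> = (\<lambda>z. if z \<in> E then q (L z) / R else 0)"
  have qL [measurable]: "(\<lambda>z. q (L z)) \<in> borel_measurable borel"
    by (rule measurable_compose[of L _ "count_space UNIV"]) auto
  have "ennreal (lam\<^sup>2) * emeasure circle_measure E
     \<le> 256 * (\<integral>\<^sup>+w. ennreal ((cmod (tail_fun N (of_real R * w)))\<^sup>2) \<partial>circle_measure)"
  proof (rule radial_maximal_inequality[where \<rho> = \<rho> and R = "R0 / R"])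
    show "(\<lambda>w. tail_fun N (of_real R * w)) \<in> borel_measurable borel" by measurable
    show "continuous_on (cball 0 1) (\<lambda>z. tail_fun N (of_real R * z))"
      by (rule continuous_on_compose2[OF holomorphic_on_imp_continuous_on[OF holomorphic_tail_fun]])
        (use R in \<open>auto intro!: continuous_intros simp: norm_mult scaled_lt_one\<close>)
    have "tail_fun N \<circ> (\<lambda>z. of_real R * z) holomorphic_on ball 0 1"
      by (rule holomorphic_on_compose_gen[OF _ holomorphic_tail_fun])
        (use R in \<open>auto intro!: holomorphic_intros simp: norm_mult scaled_lt_one\<close>)
    then show "(\<lambda>z. tail_fun N (of_real R * z)) holomorphic_on ball 0 1" by (simp add: o_def)
    show "\<rho> \<in> borel_measurable borel" unfolding \<rho>_def by measurable
    show "0 \<le> \<rho> z" for z unfolding \<rho>_def using q(1) R by (auto intro: less_imp_le)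
    show "\<rho> z \<le> R0 / R" for z unfolding \<rho>_def using R0[OF L(1)] R R0' by (auto simp: divide_right_mono)
    show "R0 / R < 1" using R by simp
    show "lam \<le> cmod (tail_fun N (of_real R * (of_real (\<rho> z) * z)))" if "z \<in> E" for z
      using L(2)[OF that] that R by (simp add: \<rho>_def)
  qed (use lam in auto)
  also have "\<dots> \<le> 256 * ennreal (tail_norm N)"
    by (intro mult_left_mono tail_fun_L2_le R) simp
  finally show "ennreal (lam\<^sup>2) * emeasure circle_measure E \<le> 256 * ennreal (tail_norm N)" .
qed

text \<open>The exceptional set \<open>Z\<close> is bad for every \<open>N\<close>, so the weak type
  bound holds on it with every \<open>tail_norm N\<close>; these tend to zero, and \<open>Z\<close>
  is null.\<close>

lemma AE_tail_fun_small:
  assumes lam: "0 < lam"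
  shows "AE z in circle_measure. \<exists>N. \<forall>r. 0 < r \<and> r < 1 \<longrightarrow> cmod (tail_fun N (of_real r * z)) \<le> lam"
proof -
  define Q where "Q = \<rat> \<inter> {0<..<1::real}"
  define q where "q = from_nat_into Q"
  have "Q \<noteq> {}" unfolding Q_def using Rats_dense_in_real[of 0 1] by auto
  have "countable Q" unfolding Q_def by (intro countable_Int1 countable_rat)
  have q: "0 < q i" "q i < 1" for i
    using from_nat_into[OF \<open>Q \<noteq> {}\<close>, of i] by (auto simp: q_def Q_def)
  define E where "E = (\<lambda>N n. {z. cmod z = 1 \<and> (\<exists>i<n. lam < cmod (tail_fun N (of_real (q i) * z)))})"
  have E_meas [measurable]: "E N n \<in> sets borel" for N n
    unfolding E_def by (rule tail_fun_weak_type_finite(2)[OF q lam])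
  have "incseq (E N)" for N unfolding E_def incseq_def by force
  then have sup: "emeasure circle_measure (\<Union>n. E N n) = (SUP n. emeasure circle_measure (E N n))" for N
    by (intro SUP_emeasure_incseq[symmetric]) auto
  have le: "ennreal (lam\<^sup>2) * emeasure circle_measure (\<Union>n. E N n) \<le> 256 * ennreal (tail_norm N)" for N
    unfolding sup SUP_mult_left_ennreal
    by (rule SUP_least) (use tail_fun_weak_type_finite(1)[OF q lam] in \<open>simp add: E_def\<close>)
  define Z where "Z = (\<Inter>N. \<Union>n. E N n)"
  have [measurable]: "Z \<in> sets borel" unfolding Z_def by measurable
  have "ennreal (lam\<^sup>2) * emeasure circle_measure Z \<le> 256 * ennreal (tail_norm N)" for N
    by (rule order_trans[OF mult_left_mono[OF emeasure_mono] le[of N]]) (auto simp: Z_def)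
  moreover have "(\<lambda>N. 256 * ennreal (tail_norm N)) \<longlonglongrightarrow> 256 * ennreal 0"
    by (intro ennreal_tendsto_cmult tendsto_ennrealI tail_norm_tendsto) simp
  ultimately have "ennreal (lam\<^sup>2) * emeasure circle_measure Z \<le> 256 * ennreal 0"
    by (intro tendsto_lowerbound[where F = sequentially and f = "\<lambda>N. 256 * ennreal (tail_norm N)"]) auto
  then have "emeasure circle_measure Z = 0" using lam by simp
  then have "AE z in circle_measure. z \<notin> Z"
    by (intro AE_not_in) (auto simp: null_sets_def)
  then show ?thesis
    using AE_circle
  proof eventually_elim
    fix z assume "z \<notin> Z" and z: "cmod z = 1"
    then obtain N where N: "\<And>n. z \<notin> E N n" unfolding Z_def by blast
    \<comment> \<open>So far only rational radii are controlled. By continuity in the radius, a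
      violation at \<open>r\<close> persists at a rational \<open>s\<close> slightly below
      \<open>r\<close>.\<close>
    have "cmod (tail_fun N (of_real r * z)) \<le> lam" if r: "0 < r" "r < 1" for r
    proof (rule ccontr)
      assume "\<not> ?thesis"
      then have gt: "lam < cmod (tail_fun N (of_real r * z))" by simp
      have "isCont (\<lambda>s. cmod (tail_fun N (of_real s * z))) r"
      proof -
        have "of_real r * z \<in> ball 0 1" using r z by (simp add: norm_mult)
        then have "isCont (tail_fun N) (of_real r * z)"
          using holomorphic_on_imp_continuous_on[OF holomorphic_tail_fun[of N]]
            continuous_on_eq_continuous_at[OF open_ball] by blast
        moreover have "isCont (\<lambda>s. complex_of_real s * z) r" by (intro continuous_intros)
        ultimately have "isCont (\<lambda>s. tail_fun N (of_real s * z)) r"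
          by (rule isCont_o2[rotated])
        then show ?thesis by (rule continuous_norm)
      qed
      then have "\<forall>\<^sub>F s in at r. lam < cmod (tail_fun N (of_real s * z))"
        using gt unfolding isCont_def by (rule order_tendstoD)
      then obtain d where d: "d > 0" "\<And>s. s \<noteq> r \<Longrightarrow> dist s r < d \<Longrightarrow> lam < cmod (tail_fun N (of_real s * z))"
        unfolding eventually_at by blast
      obtain s where s: "s \<in> \<rat>" "max 0 (r - d) < s" "s < r"
        using Rats_dense_in_real[of "max 0 (r - d)" r] d(1) r by auto
      have "s \<in> Q" using s r by (auto simp: Q_def)
      then obtain i where i: "q i = s"
        using from_nat_into_surj[OF \<open>countable Q\<close>] by (auto simp: q_def)
      have "lam < cmod (tail_fun N (of_real s * z))"
        using s by (intro d(2)) (auto simp: dist_real_def)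
      then have "z \<in> E N (Suc i)" unfolding E_def using z i by auto
      then show False using N by blast
    qed
    then show "\<exists>N. \<forall>r. 0 < r \<and> r < 1 \<longrightarrow> cmod (tail_fun N (of_real r * z)) \<le> lam" by blast
  qed
qed

text \<open>For almost every \<open>z\<close>, \<open>f\<close> is a polynomial plus a remainder
  that is small along the entire radius. The polynomial has a limit, so the radial values are
  eventually within any given \<open>e\<close> of a constant.\<close>

theorem AE_radial_limit:
  "AE z in circle_measure. \<exists>l. ((\<lambda>r. f (complex_of_real r * z)) \<longlongrightarrow> l) (at_left (1::real))"
proof -
  have "AE z in circle_measure. \<forall>j::nat. \<exists>N. \<forall>r. 0 < r \<and> r < 1 \<longrightarrow> cmod (tail_fun N (of_real r * z)) \<le> 1 / (real j + 1)"
    unfolding AE_all_countable by (intro allI AE_tail_fun_small) auto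
  then show ?thesis
    using AE_circle
  proof eventually_elim
    fix z assume small: "\<forall>j::nat. \<exists>N. \<forall>r. 0 < r \<and> r < 1 \<longrightarrow> cmod (tail_fun N (of_real r * z)) \<le> 1 / (real j + 1)"
      and z: "cmod z = 1"
    show "\<exists>l. ((\<lambda>r. f (complex_of_real r * z)) \<longlongrightarrow> l) (at_left (1::real))"
    proof (rule tendsto_if_nearly_constant)
      fix e :: real assume e: "e > 0"
      obtain j where j: "1 / (real j + 1) < e / 2"
        using nat_approx_posE[of "e / 2"] e by (auto simp: add.commute)
      obtain N where N: "\<And>r. 0 < r \<Longrightarrow> r < 1 \<Longrightarrow> cmod (tail_fun N (of_real r * z)) \<le> 1 / (real j + 1)"
        using small by blast
      define p where "p = (\<lambda>w. \<Sum>n<N. coef n * w ^ n)"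
      have "((\<lambda>r. p (of_real r * z)) \<longlongrightarrow> p (of_real 1 * z)) (at_left (1::real))"
        unfolding p_def by (intro tendsto_intros)
      then have "\<forall>\<^sub>F r in at_left (1::real). dist (p (of_real r * z)) (p z) < e / 2"
        using e by (auto dest!: tendstoD[where e = "e / 2"])
      moreover have "\<forall>\<^sub>F r in at_left (1::real). r \<in> {0<..<1}"
        by (rule eventually_at_left_real) simp
      ultimately have "\<forall>\<^sub>F r in at_left (1::real). norm (f (of_real r * z) - p z) \<le> e"
      proof eventually_elim
        case (elim r)
        have "f (of_real r * z) = tail_fun N (of_real r * z) + p (of_real r * z)"
          using elim(2) z by (simp add: tail_fun_def p_def norm_mult)
        then have "f (of_real r * z) - p z = tail_fun N (of_real r * z) + (p (of_real r * z) - p z)"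
          by simp
        then have "norm (f (of_real r * z) - p z) \<le> cmod (tail_fun N (of_real r * z)) + dist (p (of_real r * z)) (p z)"
          unfolding dist_norm by (metis norm_triangle_ineq)
        also have "\<dots> \<le> e" using N[of r] elim j by simp
        finally show ?case .
      qed
      then show "\<exists>c. \<forall>\<^sub>F r in at_left (1::real). norm (f (of_real r * z) - c) \<le> e" by blast
    qed simp
  qed
qed

end

section \<open>Approximation by harmonic polynomials\<close>

text \<open>Inner and outer regularity squeeze the set between a compact and an open set, and
  Urysohn interpolates. The measure is arbitrary because the lemma is also applied to a weighted
  circle measure.\<close>

lemma indicator_approx_continuous:
  fixes M :: "complex measure"
  assumes fin: "finite_measure M" and sb: "sets M = sets borel" and B: "B \<in> sets borel" and e: "0 < e"
  shows "\<exists>c. continuous_on UNIV c \<and> (\<forall>z. 0 \<le> c z \<and> c z \<le> (1::real)) \<and>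
    (\<integral>z. \<bar>indicator B z - c z\<bar> \<partial>M) < e"
proof -
  interpret finite_measure M by fact
  note [measurable_cong] = sb
  have em: "emeasure M (space M) \<noteq> \<infinity>" by simp
  have eB: "emeasure M B \<noteq> \<infinity>" by simp
  have "\<exists>K. K \<subseteq> B \<and> compact K \<and> measure M B < measure M K + e / 2"
  proof -
    have "\<exists>K \<in> {K. K \<subseteq> B \<and> compact K}. emeasure M B < emeasure M K + ennreal (e / 2)"
      by (rule SUP_approx_ennreal[OF _ _ inner_regular[OF sb em B] eB]) (use e in auto)
    then show ?thesis
      using e by (auto simp: emeasure_eq_measure ennreal_plus[symmetric] ennreal_less_iff simp del: ennreal_plus)
  qed
  then obtain K where K: "K \<subseteq> B" "compact K" "measure M B < measure M K + e / 2" by blast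
  have "\<exists>U. B \<subseteq> U \<and> open U \<and> measure M U < measure M B + e / 2"
  proof -
    have "\<exists>U \<in> {U. B \<subseteq> U \<and> open U}. emeasure M U < emeasure M B + ennreal (e / 2)"
      by (rule INF_approx_ennreal[OF _ outer_regular[OF sb em B] eB]) (use e in auto)
    then show ?thesis
      using e by (auto simp: emeasure_eq_measure ennreal_plus[symmetric] ennreal_less_iff simp del: ennreal_plus)
  qed
  then obtain U where U: "B \<subseteq> U" "open U" "measure M U < measure M B + e / 2" by blast
  have [measurable]: "K \<in> sets borel" "U \<in> sets borel" "B \<in> sets borel"
    using K U B by (auto intro: borel_compact borel_open)
  obtain c :: "complex \<Rightarrow> real" where c: "continuous_on UNIV c" "\<And>z. c z \<in> closed_segment 1 0"
      "\<And>z. z \<in> K \<Longrightarrow> c z = 1" "\<And>z. z \<in> - U \<Longrightarrow> c z = 0"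
    using Urysohn_local[of UNIV K "- U" "1::real" 0] K U compact_imp_closed[of K] by auto
  have c01: "0 \<le> c z" "c z \<le> 1" for z
    using c(2)[of z] by (auto simp: closed_segment_eq_real_ivl split: if_splits)
  have [measurable]: "c \<in> borel_measurable borel" by (rule borel_measurable_continuous_onI[OF c(1)])
  have le: "\<bar>indicator B z - c z\<bar> \<le> indicator (U - K) z" for z
    using c01[of z] c(3,4)[of z] K(1) U(1) by (auto split: split_indicator)
  have "(\<integral>z. \<bar>indicator B z - c z\<bar> \<partial>M) \<le> (\<integral>z. indicator (U - K) z \<partial>M)"
  proof (rule integral_mono)
    show "integrable M (\<lambda>z. \<bar>indicator B z - c z\<bar>)"
      by (rule integrable_const_bound[where B = 1]) (use c01 in \<open>auto split: split_indicator\<close>)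
    show "integrable M (indicat_real (U - K))"
      by (rule integrable_const_bound[where B = 1]) (auto split: split_indicator)
  qed (rule le)
  also have "\<dots> = measure M (U - K)"
    using sb sets_eq_imp_space_eq[OF sb] by simp
  also have "\<dots> = measure M U - measure M K"
    using K U sb by (intro finite_measure_Diff) auto
  also have "\<dots> < e" using K U by simp
  finally show ?thesis using c01 c(1) by blast
qed

lemma L1_approx_continuous:
  fixes f :: "complex \<Rightarrow> real"
  assumes "integrable circle_measure f" "0 < e"
  shows "\<exists>c. continuous_on UNIV c \<and> bounded (range c) \<and> (\<integral>z. \<bar>f z - c z\<bar> \<partial>circle_measure) < e"
proof -
  let ?M = circle_measure
  have int_c: "integrable ?M c" if "continuous_on UNIV c" "bounded (range c)" for c :: "complex \<Rightarrow> real"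
  proof -
    obtain B where "\<And>z. norm (c z) \<le> B" using \<open>bounded (range c)\<close> unfolding bounded_iff by auto
    then show ?thesis
      using that by (intro integrable_circle_bounded[of c B]) (auto intro: borel_measurable_continuous_onI)
  qed
  show ?thesis
    using assms
  proof (induction f arbitrary: e rule: integrable_induct)
    case (base A c)
    obtain d where d: "continuous_on UNIV d" "\<And>z. 0 \<le> d z \<and> d z \<le> (1::real)"
      "(\<integral>z. \<bar>indicator A z - d z\<bar> \<partial>?M) < e / (\<bar>c\<bar> + 1)"
      using indicator_approx_continuous[of ?M A "e / (\<bar>c\<bar> + 1)"] base circle.finite_measure_axioms by auto
    have "(\<integral>z. \<bar>indicator A z *\<^sub>R c - c * d z\<bar> \<partial>?M) = (\<integral>z. \<bar>c\<bar> * \<bar>indicator A z - d z\<bar> \<partial>?M)"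
      by (intro Bochner_Integration.integral_cong) (auto simp: abs_mult[symmetric] algebra_simps)
    also have "\<dots> = \<bar>c\<bar> * (\<integral>z. \<bar>indicator A z - d z\<bar> \<partial>?M)" by simp
    also have "\<dots> \<le> (\<bar>c\<bar> + 1) * (\<integral>z. \<bar>indicator A z - d z\<bar> \<partial>?M)"
      by (intro mult_right_mono) auto
    also have "\<dots> < e" using d(3) by (simp add: pos_less_divide_eq mult.commute)
    finally have "(\<integral>z. \<bar>indicator A z *\<^sub>R c - c * d z\<bar> \<partial>?M) < e" .
    moreover have "bounded (range (\<lambda>z. c * d z))"
      unfolding bounded_iff using d(2) by (intro exI[of _ "\<bar>c\<bar>"]) (auto simp: abs_mult intro!: mult_left_le)
    moreover have "continuous_on UNIV (\<lambda>z. c * d z)" by (intro continuous_intros d(1))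
    ultimately show ?case by blast
  next
    case (add f g)
    obtain c where c: "continuous_on UNIV c" "bounded (range c)" "(\<integral>z. \<bar>f z - c z\<bar> \<partial>?M) < e / 2"
      using add.IH(1)[of "e / 2"] add.prems by auto
    obtain d where d: "continuous_on UNIV d" "bounded (range d)" "(\<integral>z. \<bar>g z - d z\<bar> \<partial>?M) < e / 2"
      using add.IH(2)[of "e / 2"] add.prems by auto
    have "(\<integral>z. \<bar>(f z + g z) - (c z + d z)\<bar> \<partial>?M) \<le> (\<integral>z. \<bar>f z - c z\<bar> + \<bar>g z - d z\<bar> \<partial>?M)"
      using add.hyps int_c[OF c(1,2)] int_c[OF d(1,2)] by (intro integral_mono) auto
    also have "\<dots> = (\<integral>z. \<bar>f z - c z\<bar> \<partial>?M) + (\<integral>z. \<bar>g z - d z\<bar> \<partial>?M)"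
      using add.hyps int_c[OF c(1,2)] int_c[OF d(1,2)] by (intro Bochner_Integration.integral_add) auto
    also have "\<dots> < e" using c(3) d(3) by simp
    finally show ?case
      using c d by (intro exI[of _ "\<lambda>z. c z + d z"]) (auto intro!: continuous_intros bounded_plus_comp)
  next
    case (lim f s)
    have "(\<lambda>i. \<integral>z. \<bar>f z - s i z\<bar> \<partial>?M) \<longlonglongrightarrow> (\<integral>z. 0 \<partial>?M)"
    proof (rule integral_dominated_convergence[where w = "\<lambda>z. 3 * \<bar>f z\<bar>"])
      show "AE z in ?M. (\<lambda>i. \<bar>f z - s i z\<bar>) \<longlonglongrightarrow> 0"
      proof (rule AE_I2)
        fix z
        have "(\<lambda>i. \<bar>f z - s i z\<bar>) \<longlonglongrightarrow> \<bar>f z - f z\<bar>"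
          by (intro tendsto_intros lim.hyps) simp
        then show "(\<lambda>i. \<bar>f z - s i z\<bar>) \<longlonglongrightarrow> 0" by simp
      qed
      show "AE z in ?M. norm \<bar>f z - s i z\<bar> \<le> 3 * \<bar>f z\<bar>" for i
      proof (rule AE_I2)
        fix z
        have "\<bar>s i z\<bar> \<le> 2 * \<bar>f z\<bar>" using lim.hyps(3)[of z i] by simp
        then show "norm \<bar>f z - s i z\<bar> \<le> 3 * \<bar>f z\<bar>" by simp
      qed
    qed (use lim.hyps in auto)
    then have "\<forall>\<^sub>F i in sequentially. (\<integral>z. \<bar>f z - s i z\<bar> \<partial>?M) < e / 2"
      using lim.prems by (intro order_tendstoD(2)[of _ 0]) auto
    then obtain i where i: "(\<integral>z. \<bar>f z - s i z\<bar> \<partial>?M) < e / 2"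
      unfolding eventually_sequentially by blast
    obtain c where c: "continuous_on UNIV c" "bounded (range c)" "(\<integral>z. \<bar>s i z - c z\<bar> \<partial>?M) < e / 2"
      using lim.IH[of "e / 2" i] lim.prems by auto
    have "(\<integral>z. \<bar>f z - c z\<bar> \<partial>?M) \<le> (\<integral>z. \<bar>f z - s i z\<bar> + \<bar>s i z - c z\<bar> \<partial>?M)"
      using lim.hyps int_c[OF c(1,2)] by (intro integral_mono) auto
    also have "\<dots> = (\<integral>z. \<bar>f z - s i z\<bar> \<partial>?M) + (\<integral>z. \<bar>s i z - c z\<bar> \<partial>?M)"
      using lim.hyps int_c[OF c(1,2)] by (intro Bochner_Integration.integral_add) auto
    also have "\<dots> < e" using c(3) i by simp
    finally show ?case using c by blast
  qed
qed

text \<open>On the circle these are the real trigonometric polynomials. Encoding them as real parts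
  of analytic polynomials yields at once the \<open>Q\<close> to be exponentiated; closure under
  products relies on \<open>cnj z = 1 / z\<close> there.\<close>

definition harmonic_poly :: "(complex \<Rightarrow> real) \<Rightarrow> bool" where
  "harmonic_poly p \<longleftrightarrow> (\<exists>Q. \<forall>z. cmod z = 1 \<longrightarrow> p z = Re (poly Q z))"

lemma harmonic_poly_const: "harmonic_poly (\<lambda>_. c)"
  unfolding harmonic_poly_def by (intro exI[of _ "[:of_real c:]"]) simp

lemma harmonic_poly_add:
  assumes "harmonic_poly p" "harmonic_poly q"
  shows "harmonic_poly (\<lambda>z. p z + q z)"
proof -
  from assms obtain P Q where "\<forall>z. cmod z = 1 \<longrightarrow> p z = Re (poly P z)" "\<forall>z. cmod z = 1 \<longrightarrow> q z = Re (poly Q z)"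
    unfolding harmonic_poly_def by blast
  then show ?thesis
    unfolding harmonic_poly_def by (intro exI[of _ "P + Q"]) simp
qed

lemma harmonic_poly_sum: "finite I \<Longrightarrow> (\<And>i. i \<in> I \<Longrightarrow> harmonic_poly (p i)) \<Longrightarrow> harmonic_poly (\<lambda>z. \<Sum>i\<in>I. p i z)"
  by (induction I rule: finite_induct) (auto intro: harmonic_poly_add harmonic_poly_const)

text \<open>\<open>2 * Re u * Re v = Re (u * v + u * cnj v)\<close>, and on the circle
  \<open>z^j * cnj (z^k) = z^(j - k)\<close> if \<open>k \<le> j\<close>, so no negative powers
  arise once the larger exponent is left unconjugated.\<close>

lemma harmonic_poly_monom_mult: "harmonic_poly (\<lambda>z. Re (a * z ^ j) * Re (b * z ^ k))"
proof -
  have le: "harmonic_poly (\<lambda>z. Re (a * z ^ j) * Re (b * z ^ k))" if "k \<le> j" for a b j k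
  proof -
    have "Re (a * z ^ j) * Re (b * z ^ k) = Re (poly (monom (a * b / 2) (j + k) + monom (a * cnj b / 2) (j - k)) z)"
      if z: "cmod z = 1" for z
    proof -
      have *: "Re u * Re v = Re ((u * v + u * cnj v) / 2)" for u v :: complex by simp
      have "z ^ k * cnj (z ^ k) = 1"
        using z by (simp add: complex_norm_square[symmetric] norm_power del: complex_cnj_power)
      moreover have "z ^ j = z ^ (j - k) * z ^ k" using \<open>k \<le> j\<close> by (simp add: power_add[symmetric])
      ultimately have "z ^ j * cnj (z ^ k) = z ^ (j - k)"
        by (simp add: mult.assoc del: complex_cnj_power)
      then have eq: "(a * z ^ j) * cnj (b * z ^ k) = a * cnj b * z ^ (j - k)"
        by (metis (no_types, opaque_lifting) complex_cnj_mult mult.assoc mult.left_commute)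
      have "(a * z ^ j * (b * z ^ k) + a * z ^ j * cnj (b * z ^ k)) / 2
          = poly (monom (a * b / 2) (j + k) + monom (a * cnj b / 2) (j - k)) z"
        unfolding eq by (simp add: poly_monom power_add add_divide_distrib)
      then show ?thesis
        unfolding * by simp
    qed
    then show ?thesis unfolding harmonic_poly_def by blast
  qed
  show ?thesis
    using le[of k j a b] le[of j k b a] by (cases "k \<le> j") (auto simp: mult.commute)
qed

lemma harmonic_poly_mult:
  assumes "harmonic_poly p" "harmonic_poly q"
  shows "harmonic_poly (\<lambda>z. p z * q z)"
proof -
  from assms obtain P Q where P: "\<And>z. cmod z = 1 \<Longrightarrow> p z = Re (poly P z)"
    and Q: "\<And>z. cmod z = 1 \<Longrightarrow> q z = Re (poly Q z)"
    unfolding harmonic_poly_def by blast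
  have "harmonic_poly (\<lambda>z. \<Sum>i\<le>degree P. \<Sum>j\<le>degree Q. Re (coeff P i * z ^ i) * Re (coeff Q j * z ^ j))"
    by (intro harmonic_poly_sum harmonic_poly_monom_mult) auto
  moreover have "(\<Sum>i\<le>degree P. \<Sum>j\<le>degree Q. Re (coeff P i * z ^ i) * Re (coeff Q j * z ^ j)) = p z * q z"
    if "cmod z = 1" for z
    unfolding P[OF that] Q[OF that] poly_altdef Re_sum sum_product ..
  ultimately show ?thesis
    unfolding harmonic_poly_def by auto
qed

lemma harmonic_poly_real_polynomial_function:
  fixes p :: "complex \<Rightarrow> real"
  assumes "real_polynomial_function p"
  shows "harmonic_poly p"
  using assms
proof (induction rule: real_polynomial_function.induct)
  case (linear f)
  interpret bounded_linear f by fact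
  have "f z = Re (poly [:0, Complex (f 1) (- f \<i>):] z)" for z
  proof -
    have "z = Re z *\<^sub>R 1 + Im z *\<^sub>R \<i>" by (simp add: complex_eq_iff)
    then have "f z = Re z * f 1 + Im z * f \<i>" by (metis add scaleR real_scaleR_def)
    then show ?thesis by simp
  qed
  then show ?case unfolding harmonic_poly_def by blast
qed (auto intro: harmonic_poly_const harmonic_poly_add harmonic_poly_mult)

lemma continuous_approx_harmonic_poly:
  fixes c :: "complex \<Rightarrow> real"
  assumes "continuous_on UNIV c" "0 < e"
  obtains Q where "\<And>z. cmod z = 1 \<Longrightarrow> \<bar>c z - Re (poly Q z)\<bar> < e"
proof -
  obtain p where p: "real_polynomial_function p" "\<And>z. z \<in> sphere 0 1 \<Longrightarrow> \<bar>c z - p z\<bar> < e"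
    using Stone_Weierstrass_real_polynomial_function[of "sphere 0 1" c e] assms
    by (metis compact_sphere continuous_on_subset subset_UNIV)
  obtain Q where "\<And>z. cmod z = 1 \<Longrightarrow> p z = Re (poly Q z)"
    using harmonic_poly_real_polynomial_function[OF p(1)] unfolding harmonic_poly_def by blast
  with p(2) have "\<bar>c z - Re (poly Q z)\<bar> < e" if "cmod z = 1" for z
    using that by (metis mem_sphere_0)
  then show ?thesis by (rule that)
qed

lemma L1_approx_harmonic_poly:
  fixes f :: "complex \<Rightarrow> real"
  assumes int: "integrable circle_measure f" and f: "\<And>z. 0 \<le> f z" and e: "0 < e"
  obtains Q where "\<And>z. cmod z = 1 \<Longrightarrow> 0 \<le> Re (poly Q z)" "Im (poly Q 0) = 0"
    "(\<integral>z. \<bar>f z - Re (poly Q z)\<bar> \<partial>circle_measure) \<le> e"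
proof -
  obtain c where c: "continuous_on UNIV c" "bounded (range c)" "(\<integral>z. \<bar>f z - c z\<bar> \<partial>circle_measure) < e / 3"
    using L1_approx_continuous[OF int, of "e / 3"] e by auto
  obtain Q0 where Q0: "\<And>z. cmod z = 1 \<Longrightarrow> \<bar>max (c z) 0 - Re (poly Q0 z)\<bar> < e / 3"
    by (rule continuous_approx_harmonic_poly[of "\<lambda>z. max (c z) 0" "e / 3"])
      (use c(1) e in \<open>auto intro!: continuous_intros\<close>)
  \<comment> \<open>Adding \<open>e / 3\<close> restores nonnegativity after a uniform error below
    \<open>e / 3\<close>, and the imaginary constant makes \<open>poly Q 0\<close> real without
    changing real parts. The three errors add up to \<open>e\<close>.\<close>
  define Q where "Q = Q0 + [:of_real (e / 3) - \<i> * of_real (Im (poly Q0 0)):]"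
  have Q: "Re (poly Q z) = Re (poly Q0 z) + e / 3" for z by (simp add: Q_def)
  obtain B where B: "\<And>z. norm (c z) \<le> B" using c(2) unfolding bounded_iff by auto
  have ic: "integrable circle_measure c"
    using c(1) B by (intro integrable_circle_bounded[of c B]) (auto intro: borel_measurable_continuous_onI)
  have mQ [measurable]: "(\<lambda>z. Re (poly Q z)) \<in> borel_measurable borel"
    by (intro borel_measurable_continuous_onI continuous_intros)
  have "(\<integral>z. \<bar>f z - Re (poly Q z)\<bar> \<partial>circle_measure) \<le> (\<integral>z. \<bar>f z - c z\<bar> + 2 * e / 3 \<partial>circle_measure)"
  proof (rule integral_mono_AE')
    show "integrable circle_measure (\<lambda>z. \<bar>f z - c z\<bar> + 2 * e / 3)"
      using int ic by simp
    show "AE z in circle_measure. \<bar>f z - Re (poly Q z)\<bar> \<le> \<bar>f z - c z\<bar> + 2 * e / 3"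
      using AE_circle
    proof eventually_elim
      fix z :: complex assume "cmod z = 1"
      note Q0[OF this]
      moreover have "\<bar>f z - max (c z) 0\<bar> \<le> \<bar>f z - c z\<bar>"
        using f[of z] by (auto simp: max_def)
      ultimately show "\<bar>f z - Re (poly Q z)\<bar> \<le> \<bar>f z - c z\<bar> + 2 * e / 3"
        unfolding Q by linarith
    qed
  qed (use e in auto)
  also have "\<dots> = (\<integral>z. \<bar>f z - c z\<bar> \<partial>circle_measure) + 2 * e / 3"
    using int ic by (simp add: circle.prob_space[simplified])
  also have "\<dots> \<le> e" using c(3) by simp
  finally have "(\<integral>z. \<bar>f z - Re (poly Q z)\<bar> \<partial>circle_measure) \<le> e" .
  moreover have "0 \<le> Re (poly Q z)" if "cmod z = 1" for z
    using Q0[OF that] max.cobounded2[of 0 "c z"] unfolding Q by linarith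
  moreover have "Im (poly Q 0) = 0" by (simp add: Q_def)
  ultimately show ?thesis using that by blast
qed

section \<open>The spaces L2 and H2 of the circle\<close>

lemma L2T_measurable: "f \<in> L2T \<Longrightarrow> f \<in> borel_measurable borel"
  unfolding L2T_def by auto

lemma L2T_integrable_prod:
  assumes "f \<in> L2T" "h \<in> L2T"
  shows "integrable circle_measure (\<lambda>z. f z * cnj (h z))"
    and "integrable circle_measure (\<lambda>z. cmod (f z) * cmod (h z))"
proof -
  have [measurable]: "f \<in> borel_measurable borel" "h \<in> borel_measurable borel"
    using assms by (auto intro: L2T_measurable)
  have int: "integrable circle_measure (\<lambda>z. (cmod (f z))\<^sup>2 + (cmod (h z))\<^sup>2)"
    using assms unfolding L2T_def by auto
  have le: "cmod (f z) * cmod (h z) \<le> (cmod (f z))\<^sup>2 + (cmod (h z))\<^sup>2" for z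
  proof -
    have "2 * (cmod (f z) * cmod (h z)) \<le> (cmod (f z))\<^sup>2 + (cmod (h z))\<^sup>2"
      using sum_squares_bound[of "cmod (f z)" "cmod (h z)"] by (simp add: mult.assoc)
    moreover have "0 \<le> cmod (f z) * cmod (h z)" by simp
    ultimately show ?thesis by linarith
  qed
  show "integrable circle_measure (\<lambda>z. f z * cnj (h z))"
    by (rule Bochner_Integration.integrable_bound[OF int]) (use le in \<open>auto simp: norm_mult\<close>)
  show "integrable circle_measure (\<lambda>z. cmod (f z) * cmod (h z))"
    by (rule Bochner_Integration.integrable_bound[OF int]) (use le in auto)
qed

lemma one_in_L2T: "(\<lambda>_. 1) \<in> L2T"
  unfolding L2T_def by simp

lemma L2T_integrable:
  assumes "f \<in> L2T" shows "integrable circle_measure f"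
  using L2T_integrable_prod(1)[OF assms one_in_L2T] by simp

lemma L2T_bounded_mult:
  assumes f: "f \<in> L2T" and [measurable]: "b \<in> borel_measurable borel"
    and b: "AE z in circle_measure. cmod (b z) \<le> B"
  shows "(\<lambda>z. b z * f z) \<in> L2T"
proof -
  have [measurable]: "f \<in> borel_measurable borel" using f by (rule L2T_measurable)
  have int: "integrable circle_measure (\<lambda>z. B\<^sup>2 * (cmod (f z))\<^sup>2)"
    using f unfolding L2T_def by auto
  have "integrable circle_measure (\<lambda>z. (cmod (b z * f z))\<^sup>2)"
  proof (rule Bochner_Integration.integrable_bound[OF int])
    show "AE z in circle_measure. norm ((cmod (b z * f z))\<^sup>2) \<le> norm (B\<^sup>2 * (cmod (f z))\<^sup>2)"
      using b
    proof eventually_elim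
      case (elim z)
      then have "(cmod (b z))\<^sup>2 \<le> B\<^sup>2" by (intro power_mono) auto
      then show ?case by (simp add: norm_mult power_mult_distrib mult_right_mono)
    qed
  qed measurable
  then show ?thesis unfolding L2T_def by simp
qed

lemma bounded_in_L2T:
  assumes "b \<in> borel_measurable borel" "AE z in circle_measure. cmod (b z) \<le> B"
  shows "b \<in> L2T"
  using L2T_bounded_mult[OF one_in_L2T assms] by simp

lemma L2T_add:
  assumes f: "f \<in> L2T" and h: "h \<in> L2T"
  shows "(\<lambda>z. f z + h z) \<in> L2T"
proof -
  have [measurable]: "f \<in> borel_measurable borel" "h \<in> borel_measurable borel"
    using assms by (auto intro: L2T_measurable)
  have int: "integrable circle_measure (\<lambda>z. 2 * (cmod (f z))\<^sup>2 + 2 * (cmod (h z))\<^sup>2)"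
    using assms unfolding L2T_def by auto
  have "(cmod (f z + h z))\<^sup>2 \<le> 2 * (cmod (f z))\<^sup>2 + 2 * (cmod (h z))\<^sup>2" for z
  proof -
    have "(cmod (f z + h z))\<^sup>2 \<le> (cmod (f z) + cmod (h z))\<^sup>2"
      by (intro power_mono norm_triangle_ineq) simp
    then show ?thesis
      using sum_squares_bound[of "cmod (f z)" "cmod (h z)"] by (simp add: power2_sum)
  qed
  then have "integrable circle_measure (\<lambda>z. (cmod (f z + h z))\<^sup>2)"
    by (intro Bochner_Integration.integrable_bound[OF int]) auto
  then show ?thesis unfolding L2T_def by simp
qed

lemma L2T_cmult: "f \<in> L2T \<Longrightarrow> (\<lambda>z. c * f z) \<in> L2T"
  by (rule L2T_bounded_mult[where B = "cmod c"]) auto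

lemma L2T_diff: "f \<in> L2T \<Longrightarrow> h \<in> L2T \<Longrightarrow> (\<lambda>z. f z - h z) \<in> L2T"
  using L2T_add[OF _ L2T_cmult[of h "-1"], of f] by simp

lemma l2_inner_add: "f \<in> L2T \<Longrightarrow> h \<in> L2T \<Longrightarrow> k \<in> L2T \<Longrightarrow>
    l2_inner (\<lambda>z. f z + h z) k = l2_inner f k + l2_inner h k"
  unfolding l2_inner_def by (simp add: distrib_right L2T_integrable_prod)

lemma l2_inner_diff: "f \<in> L2T \<Longrightarrow> h \<in> L2T \<Longrightarrow> k \<in> L2T \<Longrightarrow>
    l2_inner (\<lambda>z. f z - h z) k = l2_inner f k - l2_inner h k"
  unfolding l2_inner_def by (simp add: left_diff_distrib L2T_integrable_prod)

lemma l2_inner_cmult: "l2_inner (\<lambda>z. c * f z) k = c * l2_inner f k"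
  unfolding l2_inner_def by (simp add: mult.assoc)

lemma l2_inner_commute: "l2_inner f h = cnj (l2_inner h f)"
  unfolding l2_inner_def Bochner_Integration.integral_cnj[symmetric] by (simp add: mult.commute)

lemma l2_norm_nonneg [simp]: "0 \<le> l2_norm f"
  unfolding l2_norm_def by simp

lemma l2_norm_square: "(l2_norm f)\<^sup>2 = (\<integral>z. (cmod (f z))\<^sup>2 \<partial>circle_measure)"
  unfolding l2_norm_def by simp

lemma l2_inner_self: "l2_inner f f = of_real ((l2_norm f)\<^sup>2)"
  unfolding l2_inner_def l2_norm_square complex_norm_square[symmetric]
  by (simp only: integral_complex_of_real)

lemma l2_Cauchy_Schwarz:
  assumes f: "f \<in> L2T" and h: "h \<in> L2T"
  shows "cmod (l2_inner f h) \<le> l2_norm f * l2_norm h"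
proof -
  have [measurable]: "f \<in> borel_measurable borel" "h \<in> borel_measurable borel"
    using assms by (auto intro: L2T_measurable)
  have sq: "(\<integral>\<^sup>+z. ennreal (cmod (k z)) ^ 2 \<partial>circle_measure) = ennreal ((l2_norm k)\<^sup>2)" if "k \<in> L2T" for k
    using that unfolding l2_norm_square L2T_def
    by (subst nn_integral_eq_integral[symmetric]) (auto simp: ennreal_power)
  have "cmod (l2_inner f h) \<le> (\<integral>z. cmod (f z) * cmod (h z) \<partial>circle_measure)"
    unfolding l2_inner_def by (rule order_trans[OF integral_norm_bound]) (simp add: norm_mult)
  also have "\<dots> \<le> l2_norm f * l2_norm h"
  proof (rule power2_le_imp_le)
    have "ennreal ((\<integral>z. cmod (f z) * cmod (h z) \<partial>circle_measure)\<^sup>2)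
        = (\<integral>\<^sup>+z. ennreal (cmod (f z)) * ennreal (cmod (h z)) \<partial>circle_measure)\<^sup>2"
      using nn_integral_eq_integral[OF L2T_integrable_prod(2)[OF f h]]
      by (simp add: ennreal_power[symmetric] ennreal_mult)
    also have "\<dots> \<le> ennreal ((l2_norm f)\<^sup>2) * ennreal ((l2_norm h)\<^sup>2)"
      unfolding sq[OF f, symmetric] sq[OF h, symmetric] by (rule Cauchy_Schwarz_nn_integral) auto
    also have "\<dots> = ennreal ((l2_norm f * l2_norm h)\<^sup>2)"
      by (simp add: ennreal_mult power_mult_distrib)
    finally show "(\<integral>z. cmod (f z) * cmod (h z) \<partial>circle_measure)\<^sup>2 \<le> (l2_norm f * l2_norm h)\<^sup>2"
      by (simp add: ennreal_le_iff)
  qed simp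
  finally show ?thesis .
qed

section \<open>The Hardy space described by moments\<close>

lemma H2_L2T: "f \<in> H2 \<Longrightarrow> f \<in> L2T"
  unfolding H2_def by simp

lemma circle_cnj_powi_neg:
  assumes "cmod z = 1"
  shows "cnj (z powi (- int n)) = z ^ n"
proof -
  have "z \<noteq> 0" using assms by auto
  have "cnj z * z = 1" using assms by (metis complex_norm_square mult.commute of_real_1 power_one)
  then have "inverse (cnj z) = z" by (simp add: inverse_unique)
  then show ?thesis by (simp add: power_int_minus power_inverse[symmetric])
qed

text \<open>On the circle the conjugate of a negative power is a positive one. In this form
  membership can be read off from the mean value property.\<close>

lemma H2_iff_moments:
  "f \<in> H2 \<longleftrightarrow> f \<in> L2T \<and> (\<forall>n\<ge>1. (\<integral>z. f z * z ^ n \<partial>circle_measure) = 0)"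
proof -
  have eq: "fourier_coeff f (- int n) = (\<integral>z. f z * z ^ n \<partial>circle_measure)" if "f \<in> L2T" for n
  proof -
    have [measurable]: "f \<in> borel_measurable borel" using that by (rule L2T_measurable)
    show ?thesis
      unfolding fourier_coeff_def
    proof (rule integral_cong_AE)
      show "AE z in circle_measure. f z * cnj (z powi - int n) = f z * z ^ n"
        using AE_circle by eventually_elim (simp only: circle_cnj_powi_neg)
    qed (auto simp: power_int_minus)
  qed
  show ?thesis
  proof
    assume "f \<in> H2"
    then have f: "f \<in> L2T" and 0: "\<And>k. k < 0 \<Longrightarrow> fourier_coeff f k = 0"
      unfolding H2_def by auto
    show "f \<in> L2T \<and> (\<forall>n\<ge>1. (\<integral>z. f z * z ^ n \<partial>circle_measure) = 0)"
      using f 0[of "- int _"] eq[OF f, symmetric] by simp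
  next
    assume *: "f \<in> L2T \<and> (\<forall>n\<ge>1. (\<integral>z. f z * z ^ n \<partial>circle_measure) = 0)"
    show "f \<in> H2"
      unfolding H2_def
    proof (intro CollectI conjI allI impI)
      fix k :: int assume "k < 0"
      then have k: "k = - int (nat (- k))" "nat (- k) \<ge> 1" by simp_all
      show "fourier_coeff f k = 0"
        by (subst k(1), subst eq) (use * k(2) in auto)
    qed (use * in simp)
  qed
qed

text \<open>The moments annihilate all trigonometric polynomials, hence by uniform approximation all
  continuous functions, hence by regularity all Borel indicators. The real and imaginary parts of
  \<open>x\<close> then integrate to zero over every Borel set.\<close>

lemma AE_zero_if_moments_zero:
  assumes x: "x \<in> L2T" and z1: "\<And>n. (\<integral>z. x z * z ^ n \<partial>circle_measure) = 0"
    and z2: "\<And>n. (\<integral>z. x z * cnj (z ^ n) \<partial>circle_measure) = 0"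
  shows "AE z in circle_measure. x z = 0"
proof -
  let ?M = circle_measure
  have xm [measurable]: "x \<in> borel_measurable borel" using x by (rule L2T_measurable)
  have xi: "integrable ?M x" using x by (rule L2T_integrable)
  have xb: "integrable ?M (\<lambda>z. x z * of_real (c z))"
    if [measurable]: "c \<in> borel_measurable borel" and c: "\<And>z. cmod z = 1 \<Longrightarrow> \<bar>c z\<bar> \<le> B" for c B
  proof (rule Bochner_Integration.integrable_bound)
    show "integrable ?M (\<lambda>z. B * cmod (x z))" using xi by auto
    show "AE z in ?M. norm (x z * of_real (c z)) \<le> norm (B * cmod (x z))"
      using AE_circle
    proof eventually_elim
      case (elim z)
      then have "cmod (x z) * \<bar>c z\<bar> \<le> cmod (x z) * \<bar>B\<bar>" using c[of z] by (intro mult_left_mono) auto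
      then show ?case by (simp add: norm_mult mult.commute)
    qed
  qed measurable
  have poly0: "(\<integral>z. x z * of_real (Re (poly Q z)) \<partial>?M) = 0" for Q
  proof -
    have ae: "AE z in ?M. cmod (a * z ^ n) \<le> cmod a" "AE z in ?M. cmod (cnj (a * z ^ n)) \<le> cmod a" for a n
      using AE_circle by (auto simp: norm_mult norm_power elim!: eventually_mono)
    have i1: "integrable ?M (\<lambda>z. x z * (a * z ^ n))" for a n
      using L2T_integrable[OF L2T_bounded_mult[OF x _ ae(1)[of a n]]] by (simp add: mult.commute[of "x _"])
    have i2: "integrable ?M (\<lambda>z. x z * cnj (a * z ^ n))" for a n
      using L2T_integrable[OF L2T_bounded_mult[OF x _ ae(2)[of a n]]] by (simp add: mult.commute[of "x _"])
    have "(\<integral>z. x z * of_real (Re (poly Q z)) \<partial>?M)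
      = (\<integral>z. (\<Sum>n\<le>degree Q. x z * (coeff Q n * z ^ n) + x z * cnj (coeff Q n * z ^ n)) / 2 \<partial>?M)"
    proof (rule Bochner_Integration.integral_cong)
      fix z
      have "x z * of_real (Re (poly Q z)) = (x z * poly Q z + x z * cnj (poly Q z)) / 2"
        using complex_add_cnj[of "poly Q z"] by (simp add: distrib_left[symmetric])
      then show "x z * of_real (Re (poly Q z))
          = (\<Sum>n\<le>degree Q. x z * (coeff Q n * z ^ n) + x z * cnj (coeff Q n * z ^ n)) / 2"
        by (simp only: poly_altdef cnj_sum sum_distrib_left sum.distrib)
    qed simp
    also have "\<dots> = (\<Sum>n\<le>degree Q. (\<integral>z. x z * (coeff Q n * z ^ n) \<partial>?M)
        + (\<integral>z. x z * cnj (coeff Q n * z ^ n) \<partial>?M)) / 2"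
      using i1 i2 by (simp add: Bochner_Integration.integral_sum Bochner_Integration.integral_add del: complex_cnj_mult complex_cnj_power)
    also have "\<dots> = 0"
    proof -
      have "(\<integral>z. x z * (a * z ^ n) \<partial>?M) = 0" for a n
      proof -
        have "(\<integral>z. x z * (a * z ^ n) \<partial>?M) = a * (\<integral>z. x z * z ^ n \<partial>?M)"
          by (subst integral_mult_right_zero[symmetric]) (simp add: mult_ac)
        then show ?thesis using z1 by simp
      qed
      moreover have "(\<integral>z. x z * cnj (a * z ^ n) \<partial>?M) = 0" for a n
      proof -
        have "(\<integral>z. x z * cnj (a * z ^ n) \<partial>?M) = cnj a * (\<integral>z. x z * cnj (z ^ n) \<partial>?M)"
          by (subst integral_mult_right_zero[symmetric]) (simp add: mult_ac)
        then show ?thesis using z2 by simp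
      qed
      ultimately show ?thesis by simp
    qed
    finally show ?thesis .
  qed
  define X where "X = (\<integral>z. cmod (x z) \<partial>?M) + 1"
  have "0 \<le> (\<integral>z. cmod (x z) \<partial>?M)" by simp
  then have X: "X > 0" "(\<integral>z. cmod (x z) \<partial>?M) \<le> X" unfolding X_def by linarith+
  have diff_le: "cmod (\<integral>z. x z * of_real (c z) \<partial>?M) \<le> cmod (\<integral>z. x z * of_real (d z) \<partial>?M) + (\<integral>z. cmod (x z) * \<bar>c z - d z\<bar> \<partial>?M)"
    if c: "c \<in> borel_measurable borel" "\<And>z. cmod z = 1 \<Longrightarrow> \<bar>c z\<bar> \<le> B"
      and d: "d \<in> borel_measurable borel" "\<And>z. cmod z = 1 \<Longrightarrow> \<bar>d z\<bar> \<le> B'" for c d B B'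
  proof -
    have "(\<integral>z. x z * of_real (c z) \<partial>?M) = (\<integral>z. x z * of_real (d z) \<partial>?M) + (\<integral>z. x z * of_real (c z - d z) \<partial>?M)"
      using xb[OF c] xb[OF d] by (simp add: right_diff_distrib)
    then have "cmod (\<integral>z. x z * of_real (c z) \<partial>?M) \<le> cmod (\<integral>z. x z * of_real (d z) \<partial>?M) + cmod (\<integral>z. x z * of_real (c z - d z) \<partial>?M)"
      by (simp only: norm_triangle_ineq)
    also have "cmod (\<integral>z. x z * of_real (c z - d z) \<partial>?M) \<le> (\<integral>z. cmod (x z) * \<bar>c z - d z\<bar> \<partial>?M)"
      by (rule order_trans[OF integral_norm_bound]) (simp add: norm_mult del: of_real_diff)
    finally show ?thesis by simp
  qed
  have cont0: "(\<integral>z. x z * of_real (c z) \<partial>?M) = 0" if c: "continuous_on UNIV c" for c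
  proof -
    have c_meas [measurable]: "c \<in> borel_measurable borel" using c by (rule borel_measurable_continuous_onI)
    have "cmod (\<integral>z. x z * of_real (c z) \<partial>?M) \<le> e" if e: "e > 0" for e
    proof -
      obtain Q where Q: "\<And>z. cmod z = 1 \<Longrightarrow> \<bar>c z - Re (poly Q z)\<bar> < e / X"
        using continuous_approx_harmonic_poly[OF c, of "e / X"] e X by auto
      have bd: "\<exists>B. \<forall>z. cmod z = 1 \<longrightarrow> \<bar>k z\<bar> \<le> B" if "continuous_on UNIV k" for k :: "complex \<Rightarrow> real"
      proof -
        have "bounded (k ` sphere 0 1)"
          by (intro compact_imp_bounded compact_continuous_image continuous_on_subset[OF that]) auto
        then obtain B where "\<And>y. y \<in> k ` sphere 0 1 \<Longrightarrow> norm y \<le> B" unfolding bounded_iff by blast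
        then show ?thesis by (intro exI[of _ B]) auto
      qed
      have cQ: "continuous_on UNIV (\<lambda>z. Re (poly Q z))" by (intro continuous_intros)
      obtain B where B: "\<And>z. cmod z = 1 \<Longrightarrow> \<bar>c z\<bar> \<le> B" using bd[OF c] by blast
      obtain B' where B': "\<And>z. cmod z = 1 \<Longrightarrow> \<bar>Re (poly Q z)\<bar> \<le> B'" using bd[OF cQ] by blast
      have [measurable]: "(\<lambda>z. Re (poly Q z)) \<in> borel_measurable borel" using cQ by (rule borel_measurable_continuous_onI)
      have "cmod (\<integral>z. x z * of_real (c z) \<partial>?M)
          \<le> cmod (\<integral>z. x z * of_real (Re (poly Q z)) \<partial>?M) + (\<integral>z. cmod (x z) * \<bar>c z - Re (poly Q z)\<bar> \<partial>?M)"
        by (rule diff_le[where c = c and d = "\<lambda>z. Re (poly Q z)", OF _ B _ B']) auto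
      also have "\<dots> = (\<integral>z. cmod (x z) * \<bar>c z - Re (poly Q z)\<bar> \<partial>?M)" by (simp add: poly0)
      also have "\<dots> \<le> (\<integral>z. cmod (x z) * (e / X) \<partial>?M)"
      proof (rule integral_mono_AE')
        show "integrable ?M (\<lambda>z. cmod (x z) * (e / X))" using xi by auto
        show "AE z in ?M. cmod (x z) * \<bar>c z - Re (poly Q z)\<bar> \<le> cmod (x z) * (e / X)"
          using AE_circle by eventually_elim (intro mult_left_mono less_imp_le[OF Q], auto)
      qed (use e X in auto)
      also have "\<dots> = (\<integral>z. cmod (x z) \<partial>?M) * (e / X)" by simp
      also have "\<dots> \<le> X * (e / X)" using X e by (intro mult_right_mono) auto
      also have "\<dots> = e" using X by simp
      finally show ?thesis .
    qed
    then have "cmod (\<integral>z. x z * of_real (c z) \<partial>?M) \<le> 0" by (rule field_le_epsilon[of _ 0, simplified])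
    then show ?thesis by simp
  qed
  have set0: "(\<integral>z. x z * of_real (indicator B z) \<partial>?M) = 0" if B [measurable]: "B \<in> sets borel" for B
  proof -
    \<comment> \<open>Since \<open>x\<close> may be unbounded, closeness in the \<open>L1\<close>
      norm of the circle measure would not control the error; with the weight
      \<open>cmod (x z)\<close> in the measure, the approximation error is the quantity to be
      bounded.\<close>
    define N where "N = density ?M (\<lambda>z. ennreal (cmod (x z)))"
    have fin: "finite_measure N"
    proof (rule finite_measureI)
      have "emeasure N (space N) = (\<integral>\<^sup>+z. ennreal (cmod (x z)) \<partial>?M)"
        unfolding N_def by (subst emeasure_density) auto
      also have "\<dots> < \<infinity>" using xi by (simp add: integrable_iff_bounded)
      finally show "emeasure N (space N) \<noteq> \<infinity>" by simp
    qed
    have sN: "sets N = sets borel" unfolding N_def by simp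
    have "cmod (\<integral>z. x z * of_real (indicator B z) \<partial>?M) \<le> e" if e: "e > 0" for e
    proof -
      obtain c where c: "continuous_on UNIV c" "\<And>z. 0 \<le> c z \<and> c z \<le> (1::real)"
        "(\<integral>z. \<bar>indicator B z - c z\<bar> \<partial>N) < e"
        using indicator_approx_continuous[OF fin sN B e] by blast
      have c_meas [measurable]: "c \<in> borel_measurable borel" using c(1) by (rule borel_measurable_continuous_onI)
      have "cmod (\<integral>z. x z * of_real (indicator B z) \<partial>?M)
          \<le> cmod (\<integral>z. x z * of_real (c z) \<partial>?M) + (\<integral>z. cmod (x z) * \<bar>indicator B z - c z\<bar> \<partial>?M)"
        by (rule diff_le[where B = 1 and B' = 1]) (use c(2) in \<open>auto split: split_indicator\<close>)
      also have "\<dots> = (\<integral>z. \<bar>indicator B z - c z\<bar> \<partial>N)"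
        unfolding N_def by (subst integral_density) (auto simp: cont0[OF c(1)])
      finally show ?thesis using c(3) by simp
    qed
    then have "cmod (\<integral>z. x z * of_real (indicator B z) \<partial>?M) \<le> 0" by (rule field_le_epsilon[of _ 0, simplified])
    then show ?thesis by simp
  qed
  have int_ind: "integrable ?M (\<lambda>z. x z * of_real (indicator B z))" if "B \<in> sets borel" for B
    using xb[of "indicator B" 1] that by (auto split: split_indicator)
  have "AE z in ?M. Re (x z) = 0"
  proof (rule density_unique_real)
    fix B assume "B \<in> sets ?M"
    then have B: "B \<in> sets borel" by simp
    have "(\<integral>z. Re (x z * of_real (indicator B z)) \<partial>?M) = 0"
      unfolding integral_Re[OF int_ind[OF B]] set0[OF B] by simp
    then show "(LINT z:B|?M. Re (x z)) = (LINT z:B|?M. 0)"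
      by (simp add: set_lebesgue_integral_def mult.commute)
  qed (use xi in auto)
  moreover have "AE z in ?M. Im (x z) = 0"
  proof (rule density_unique_real)
    fix B assume "B \<in> sets ?M"
    then have B: "B \<in> sets borel" by simp
    have "(\<integral>z. Im (x z * of_real (indicator B z)) \<partial>?M) = 0"
      unfolding integral_Im[OF int_ind[OF B]] set0[OF B] by simp
    then show "(LINT z:B|?M. Im (x z)) = (LINT z:B|?M. 0)"
      by (simp add: set_lebesgue_integral_def mult.commute)
  qed (use xi in auto)
  ultimately show ?thesis
    by eventually_elim (simp add: complex_eq_iff)
qed

text \<open>Moments against positive powers already vanish for \<open>x\<close> in
  \<open>H2\<close>. If all pairings with \<open>z^j\<close> vanished as well, \<open>x\<close>
  would be zero almost everywhere.\<close>

lemma H2_nonzero_coefficient: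
  assumes x: "x \<in> H2" and nz: "l2_norm x \<noteq> 0"
  obtains j where "l2_inner (\<lambda>z. z ^ j) x \<noteq> 0"
proof -
  have "\<exists>j. l2_inner (\<lambda>z. z ^ j) x \<noteq> 0"
  proof (rule ccontr)
    assume "\<not> ?thesis"
    then have 0: "l2_inner (\<lambda>z. z ^ j) x = 0" for j by blast
    have z2: "(\<integral>z. x z * cnj (z ^ n) \<partial>circle_measure) = 0" for n
      using l2_inner_commute[of x "\<lambda>z. z ^ n"] 0[of n] unfolding l2_inner_def by simp
    have z1: "(\<integral>z. x z * z ^ n \<partial>circle_measure) = 0" for n
      using x z2[of 0] unfolding H2_iff_moments by (cases "n = 0") auto
    have "AE z in circle_measure. x z = 0"
      by (rule AE_zero_if_moments_zero[OF H2_L2T[OF x] z1 z2])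
    then have "(\<integral>z. (cmod (x z))\<^sup>2 \<partial>circle_measure) = 0"
      by (intro integral_eq_zero_AE) (auto elim!: eventually_mono)
    then show False using nz by (simp add: l2_norm_def)
  qed
  then show ?thesis using that by blast
qed

section \<open>Multipliers with small mean\<close>

text \<open>One fixed sequence of radii: limits along it of Borel functions are Borel, and dominated
  convergence applies to sequences.\<close>

definition rad :: "nat \<Rightarrow> real" where
  "rad n = 1 - inverse (real (Suc (Suc n)))"

lemma rad_bounds: "0 < rad n" "rad n < 1"
  by (auto simp: rad_def field_simps)

lemma rad_at_left: "filterlim rad (at_left 1) sequentially"
proof -
  have "(\<lambda>n. 1 - inverse (real (Suc (Suc n)))) \<longlonglongrightarrow> 1 - 0"
    by (intro tendsto_diff tendsto_const LIMSEQ_Suc[OF LIMSEQ_inverse_real_of_nat])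
  then have "rad \<longlonglongrightarrow> 1" by (simp add: rad_def[abs_def])
  moreover have "rad n \<in> {..<1} \<and> rad n \<noteq> 1" for n
    using rad_bounds(2)[of n] by simp
  ultimately show ?thesis
    by (simp add: filterlim_at)
qed

lemma Hinfty_boundary_function:
  assumes "g \<in> Hinfty"
  obtains G where "G \<in> borel_measurable borel"
    "AE z in circle_measure. boundary_value g z = G z \<and> (\<lambda>n. g (of_real (rad n) * z)) \<longlonglongrightarrow> G z"
proof -
  from assms have hol: "g holomorphic_on ball 0 1" and "bounded (g ` ball 0 1)" unfolding Hinfty_def by auto
  then obtain M where M: "\<And>y. y \<in> g ` ball 0 1 \<Longrightarrow> cmod y \<le> M" unfolding bounded_iff by blast
  interpret bounded_disc_function g M
    by unfold_locales (use hol M in auto)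
  define G where "G = (\<lambda>z. lim (\<lambda>n. tail_fun 0 (of_real (rad n) * z)))"
  have [measurable]: "G \<in> borel_measurable borel" unfolding G_def by measurable
  moreover have "AE z in circle_measure. boundary_value g z = G z \<and> (\<lambda>n. g (of_real (rad n) * z)) \<longlonglongrightarrow> G z"
    using AE_radial_limit AE_circle
  proof eventually_elim
    fix z assume "\<exists>l. ((\<lambda>r. g (complex_of_real r * z)) \<longlongrightarrow> l) (at_left (1::real))" and z: "cmod z = 1"
    then obtain l where l: "((\<lambda>r. g (complex_of_real r * z)) \<longlongrightarrow> l) (at_left (1::real))" by blast
    have bv: "boundary_value g z = l"
      unfolding boundary_value_def by (rule tendsto_Lim[OF _ l]) simp
    have lim: "(\<lambda>n. g (of_real (rad n) * z)) \<longlonglongrightarrow> l"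
      by (rule filterlim_compose[OF l rad_at_left])
    moreover have "tail_fun 0 (of_real (rad n) * z) = g (of_real (rad n) * z)" for n
      using rad_bounds[of n] z by (simp add: tail_fun_def norm_mult)
    ultimately have "G z = l" unfolding G_def by (simp add: limI)
    then show "boundary_value g z = G z \<and> (\<lambda>n. g (of_real (rad n) * z)) \<longlonglongrightarrow> G z"
      using bv lim by simp
  qed
  ultimately show ?thesis using that by blast
qed

text \<open>For the dilates of \<open>g\<close> the function \<open>u * g^(-m) * w^n\<close> is
  holomorphic inside the disc, continuous up to the circle and zero at the origin, so its mean
  vanishes. The bound \<open>1 \<le> cmod (g z)\<close> dominates the passage to the radial
  limit.\<close>

lemma entire_times_inverse_power_H2:
  assumes hol: "g holomorphic_on ball 0 1" and ge: "\<And>z. cmod z < 1 \<Longrightarrow> 1 \<le> cmod (g z)"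
    and [measurable]: "G \<in> borel_measurable borel"
    and G: "AE z in circle_measure. (\<lambda>n. g (of_real (rad n) * z)) \<longlonglongrightarrow> G z"
    and G1: "AE z in circle_measure. 1 < cmod (G z)"
    and u: "u holomorphic_on UNIV"
  shows "(\<lambda>z. u z * inverse (G z) ^ m) \<in> H2"
proof -
  let ?M = circle_measure
  have uc: "continuous_on A u" for A
    using holomorphic_on_imp_continuous_on[OF u] by (rule continuous_on_subset) simp
  have [measurable]: "u \<in> borel_measurable borel" by (rule borel_measurable_continuous_onI[OF uc])
  obtain B where B: "\<And>z. cmod z \<le> 1 \<Longrightarrow> cmod (u z) \<le> B"
    using continuous_on_cball_bounded[OF uc] by blast
  have inv: "cmod (inverse w ^ m) \<le> 1" if "1 \<le> cmod w" for w
    using that by (auto simp: norm_power norm_inverse intro!: power_le_one inverse_le_1_iff[THEN iffD2])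
  have L2: "(\<lambda>z. u z * inverse (G z) ^ m) \<in> L2T"
  proof (rule bounded_in_L2T)
    show "AE z in ?M. cmod (u z * inverse (G z) ^ m) \<le> B * 1"
      using AE_circle G1
      by eventually_elim (unfold norm_mult, intro mult_mono B inv, use order_trans[OF norm_ge_zero B[of 0]] in auto)
  qed measurable
  have "(\<integral>z. u z * inverse (G z) ^ m * z ^ n \<partial>?M) = 0" if n: "n \<ge> 1" for n
  proof -
    \<comment> \<open>Zero off the disc, for measurability only; all values used come from points
      inside.\<close>
    define gt where "gt = (\<lambda>w. if w \<in> ball 0 1 then g w else 0)"
    have [measurable]: "gt \<in> borel_measurable borel"
      unfolding gt_def by (rule borel_measurable_continuous_on_if)
        (auto intro!: continuous_intros holomorphic_on_imp_continuous_on[OF hol])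
    define h where "h = (\<lambda>k w. u w * inverse (gt (of_real (rad k) * w)) ^ m * w ^ n)"
    have gt_eq: "gt (of_real (rad k) * w) = g (of_real (rad k) * w)" "cmod (of_real (rad k) * w) < 1" if "cmod w \<le> 1" for k w
      using rad_bounds[of k] that by (auto simp: gt_def norm_mult scaled_lt_one)
    have h0: "(\<integral>z. h k z \<partial>?M) = 0" for k
    proof -
      have holg: "(\<lambda>w. g (of_real (rad k) * w)) holomorphic_on ball 0 1"
      proof -
        have "(\<lambda>w. complex_of_real (rad k) * w) ` ball 0 1 \<subseteq> ball 0 1"
          using gt_eq(2)[of _ k] by (auto simp: less_imp_le)
        then show ?thesis
          using holomorphic_on_compose_gen[OF _ hol, of "\<lambda>w. of_real (rad k) * w" "ball 0 1"]
          by (auto simp: o_def intro!: holomorphic_intros)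
      qed
      have contg: "continuous_on (cball 0 1) (\<lambda>w. g (of_real (rad k) * w))"
        by (rule continuous_on_compose2[OF holomorphic_on_imp_continuous_on[OF hol]])
          (use gt_eq(2)[of _ k] in \<open>auto intro!: continuous_intros\<close>)
      have ne: "g (of_real (rad k) * w) \<noteq> 0" if "cmod w \<le> 1" for w
        using ge[OF gt_eq(2)[OF that, of k]] by auto
      have "(\<integral>z. h k z \<partial>?M) = h k 0"
      proof (rule mean_value_circle_measure)
        show "h k \<in> borel_measurable borel" unfolding h_def by measurable
        have "continuous_on (cball 0 1) (\<lambda>w. u w * inverse (g (of_real (rad k) * w)) ^ m * w ^ n)"
          by (intro continuous_intros uc contg) (use ne in auto)
        then show "continuous_on (cball 0 1) (h k)"
          by (rule continuous_on_eq) (simp add: h_def gt_eq)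
        have "(\<lambda>w. u w * inverse (g (of_real (rad k) * w)) ^ m * w ^ n) holomorphic_on ball 0 1"
          by (intro holomorphic_intros holg holomorphic_on_subset[OF u]) (use ne in auto)
        then show "h k holomorphic_on ball 0 1"
          by (rule holomorphic_transform) (simp add: h_def gt_eq)
      qed
      also have "h k 0 = 0" using n by (simp add: h_def)
      finally show ?thesis .
    qed
    have "(\<lambda>k. \<integral>z. h k z \<partial>?M) \<longlonglongrightarrow> (\<integral>z. u z * inverse (G z) ^ m * z ^ n \<partial>?M)"
    proof (rule integral_dominated_convergence[where w = "\<lambda>_. B"])
      show "AE z in ?M. (\<lambda>k. h k z) \<longlonglongrightarrow> u z * inverse (G z) ^ m * z ^ n"
        using AE_circle G G1
      proof eventually_elim
        fix z assume z: "cmod z = 1" and lim: "(\<lambda>n. g (of_real (rad n) * z)) \<longlonglongrightarrow> G z" and "1 < cmod (G z)"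
        then have "G z \<noteq> 0" by auto
        then have "(\<lambda>k. u z * inverse (g (of_real (rad k) * z)) ^ m * z ^ n) \<longlonglongrightarrow> u z * inverse (G z) ^ m * z ^ n"
          by (intro tendsto_intros lim)
        then show "(\<lambda>k. h k z) \<longlonglongrightarrow> u z * inverse (G z) ^ m * z ^ n"
          using z by (simp add: h_def gt_eq)
      qed
      show "AE z in ?M. norm (h k z) \<le> B" for k
        using AE_circle
      proof eventually_elim
        fix z :: complex assume z: "cmod z = 1"
        have "cmod (u z) * cmod (inverse (g (of_real (rad k) * z)) ^ m) \<le> B * 1"
          using z gt_eq(2)[of z k] order_trans[OF norm_ge_zero B[of z]]
          by (intro mult_mono B inv ge) auto
        then show "norm (h k z) \<le> B"
          using z by (simp add: h_def gt_eq norm_mult norm_power)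
      qed
    qed (auto simp: h_def)
    then show ?thesis using LIMSEQ_unique[OF _ tendsto_const[of 0]] by (simp add: h0)
  qed
  with L2 show ?thesis unfolding H2_iff_moments by simp
qed

text \<open>For \<open>t \<le> 1\<close> the square of \<open>1 + t / 3\<close> is at most
  \<open>1 + t\<close>, so \<open>a^(2 * m)\<close> dominates the fourth power of
  \<open>(1 + t / 3)^m\<close>, which by Bernoulli exceeds \<open>m * t / 3\<close>;
  \<open>81 = 3^4\<close>.\<close>

lemma quartic_decay:
  fixes t a :: real
  assumes t: "0 < t" "t \<le> 1" and a: "1 + t \<le> a" and m: "m \<ge> 1"
  shows "t ^ 4 * inverse a ^ (2 * m) \<le> 81 / real m ^ 4"
proof -
  have "t * t \<le> t * 1" using t by (intro mult_left_mono) auto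
  moreover have "(1 + t / 3)\<^sup>2 = 1 + 2 * t / 3 + t * t / 9" by (simp add: power2_eq_square algebra_simps)
  ultimately have "(1 + t / 3)\<^sup>2 \<le> 1 + t" using t by linarith
  then have le: "(1 + t / 3)\<^sup>2 \<le> a" using a by simp
  have "real m * t / 3 \<le> 1 + real m * (t / 3)" by simp
  also have "\<dots> \<le> (1 + t / 3) ^ m" using t by (intro Bernoulli_inequality) simp
  finally have "(real m * t / 3) ^ 4 \<le> ((1 + t / 3) ^ m) ^ 4"
    using t by (intro power_mono) auto
  also have "\<dots> = ((1 + t / 3)\<^sup>2) ^ (2 * m)" by (simp add: power_mult[symmetric] mult.commute)
  also have "\<dots> \<le> a ^ (2 * m)" by (intro power_mono le) simp
  finally have "real m ^ 4 * t ^ 4 \<le> 81 * a ^ (2 * m)"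
    by (simp add: power_mult_distrib power_divide)
  moreover have "0 < a ^ (2 * m)" using t a by simp
  moreover have "0 < real m ^ 4" using m by simp
  ultimately show ?thesis
    by (simp add: power_inverse field_simps)
qed

text \<open>Exchanges the polynomial \<open>q = Re Q\<close> for its target \<open>p\<close> inside
  the exponential at a cost linear in the error, so that \<open>L1\<close> approximation is
  enough.\<close>

lemma exp_minus_le:
  fixes p q :: real
  assumes "0 \<le> p" "0 \<le> q"
  shows "exp (- 2 * q) \<le> exp (- 2 * p) + 2 * \<bar>p - q\<bar>"
proof -
  have "exp (- 2 * q) * (1 + (- 2 * (p - q))) \<le> exp (- 2 * q) * exp (- 2 * (p - q))"
    by (intro mult_left_mono exp_ge_add_one_self) simp
  also have "\<dots> = exp (- 2 * p)" by (simp add: exp_add[symmetric])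
  finally have "exp (- 2 * q) \<le> exp (- 2 * p) + exp (- 2 * q) * (2 * (p - q))" by (simp add: algebra_simps)
  also have "exp (- 2 * q) * (2 * (p - q)) \<le> 1 * (2 * \<bar>p - q\<bar>)"
  proof -
    have "exp (- 2 * q) * (2 * (p - q)) \<le> exp (- 2 * q) * (2 * \<bar>p - q\<bar>)" by (intro mult_left_mono) auto
    also have "\<dots> \<le> 1 * (2 * \<bar>p - q\<bar>)" using assms by (intro mult_right_mono) auto
    finally show ?thesis .
  qed
  finally show ?thesis by simp
qed

lemma measurable_poly [measurable]: "(\<lambda>z. poly (Q :: complex poly) z) \<in> borel_measurable borel"
  by (intro borel_measurable_continuous_onI continuous_intros)

lemma integral_Re_poly: "(\<integral>z. Re (poly Q z) \<partial>circle_measure) = Re (poly Q 0)"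
  and integrable_poly: "integrable circle_measure (poly Q)"
proof -
  have cont: "continuous_on (cball 0 1) (poly Q)" by (intro continuous_intros)
  obtain B where "\<And>z. cmod z \<le> 1 \<Longrightarrow> cmod (poly Q z) \<le> B"
    using continuous_on_cball_bounded[OF cont] by blast
  then show int: "integrable circle_measure (poly Q)"
    by (intro integrable_circle_bounded[where B = B]) auto
  have "integral\<^sup>L circle_measure (poly Q) = poly Q 0"
    by (rule mean_value_circle_measure[OF _ cont]) (auto intro!: holomorphic_intros)
  then show "(\<integral>z. Re (poly Q z) \<partial>circle_measure) = Re (poly Q 0)"
    using integral_Re[OF int] by simp
qed

text \<open>
  This replaces the outer function of modulus \<open>min 1 (\<bar>G\<bar> - 1)\<^sup>2\<close>: a polynomial \<open>Q\<close> depending on \<open>m\<close>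
  suffices, since only an integral bound on \<open>exp (- Q) / G\<^sup>m\<close> is needed.
\<close>

lemma small_mean_multiplier:
  assumes [measurable]: "G \<in> borel_measurable borel"
    and G1: "AE z in circle_measure. 1 < cmod (G z)"
    and log: "integrable circle_measure (\<lambda>z. ln (cmod (G z) - 1))" and e: "0 < e"
  shows "\<exists>C\<ge>0. \<forall>m\<ge>1. \<exists>Q. (\<forall>z. cmod z = 1 \<longrightarrow> 0 \<le> Re (poly Q z)) \<and> Im (poly Q 0) = 0 \<and> Re (poly Q 0) \<le> e \<and>
    (\<integral>z. exp (- 2 * Re (poly Q z)) * inverse (cmod (G z)) ^ (2 * m) \<partial>circle_measure) \<le> C / real m ^ 4"
proof -
  let ?M = circle_measure
  \<comment> \<open>With \<open>t = min 1 (cmod (G z) - 1)\<close> this is \<open>- 2 * ln t\<close>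
    where \<open>cmod (G z) > 1\<close>, and \<open>exp (- 2 * k z)\<close> is \<open>t^4\<close>,
    the weight in \<open>quartic_decay\<close>. Capping at 1 keeps \<open>k\<close> zero where
    \<open>G\<close> is large.\<close>
  define k where "k = (\<lambda>z. 2 * \<bar>ln (min 1 (cmod (G z) - 1))\<bar>)"
  have [measurable]: "k \<in> borel_measurable borel" unfolding k_def by measurable
  have k_int: "integrable ?M k"
  proof (rule Bochner_Integration.integrable_bound)
    show "integrable ?M (\<lambda>z. 2 * \<bar>ln (cmod (G z) - 1)\<bar>)" using log by auto
    show "AE z in ?M. norm (k z) \<le> norm (2 * \<bar>ln (cmod (G z) - 1)\<bar>)"
      by (rule AE_I2) (auto simp: k_def min_def)
  qed measurable
  \<comment> \<open>The part of \<open>k\<close> above level \<open>n\<close>. Its integral tends to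
    zero with growing \<open>n\<close>, which bounds the mean of \<open>Re Q\<close>, while
    \<open>k - n \<le> \<kappa> n\<close> loses only a constant factor in the exponential.\<close>
  define \<kappa> where "\<kappa> = (\<lambda>n::nat. \<lambda>z. max 0 (k z - real n))"
  have [measurable]: "\<kappa> n \<in> borel_measurable borel" for n unfolding \<kappa>_def by measurable
  have k0: "0 \<le> k z" for z by (simp add: k_def)
  have \<kappa>_le: "0 \<le> \<kappa> n z" "\<kappa> n z \<le> k z" for n z using k0[of z] by (auto simp: \<kappa>_def)
  have \<kappa>_int: "integrable ?M (\<kappa> n)" for n
    by (rule Bochner_Integration.integrable_bound[OF k_int]) (use \<kappa>_le k0 in auto)
  have "(\<lambda>n. \<integral>z. \<kappa> n z \<partial>?M) \<longlonglongrightarrow> (\<integral>z. 0 \<partial>?M)"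
  proof (rule integral_dominated_convergence[where w = k])
    show "AE z in ?M. (\<lambda>n. \<kappa> n z) \<longlonglongrightarrow> 0"
    proof (rule AE_I2)
      fix z
      obtain N :: nat where "k z \<le> real N" using real_arch_simple by blast
      then have "\<forall>n\<ge>N. \<kappa> n z = 0" by (auto simp: \<kappa>_def)
      then show "(\<lambda>n. \<kappa> n z) \<longlonglongrightarrow> 0"
        by (intro tendsto_eventually) (auto simp: eventually_sequentially)
    qed
  qed (use k_int \<kappa>_le in auto)
  then have "\<forall>\<^sub>F n in sequentially. (\<integral>z. \<kappa> n z \<partial>?M) < e / 2"
    using e by (intro order_tendstoD(2)[of _ 0]) auto
  then obtain n where n: "(\<integral>z. \<kappa> n z \<partial>?M) < e / 2"
    unfolding eventually_sequentially by blast
  \<comment> \<open>The first summand is the quartic bound times the loss from truncation at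
    \<open>n\<close>; the 2 pays for the polynomial approximation. Since \<open>n\<close> is fixed
    before \<open>m\<close>, so is \<open>C\<close>.\<close>
  define C where "C = 81 * exp (2 * real n) + 2"
  have "C \<ge> 0" by (simp add: C_def)
  moreover have "\<exists>Q. (\<forall>z. cmod z = 1 \<longrightarrow> 0 \<le> Re (poly Q z)) \<and> Im (poly Q 0) = 0 \<and> Re (poly Q 0) \<le> e \<and>
    (\<integral>z. exp (- 2 * Re (poly Q z)) * inverse (cmod (G z)) ^ (2 * m) \<partial>?M) \<le> C / real m ^ 4" if m: "m \<ge> 1" for m :: nat
  proof -
    \<comment> \<open>\<open>e / 2\<close> keeps the mean of \<open>Re Q\<close> below
      \<open>e\<close>; \<open>1 / m^4\<close> keeps the approximation error at the size of the
      desired decay. This is why \<open>Q\<close> depends on \<open>m\<close>.\<close>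
    define \<delta> where "\<delta> = min (e / 2) (1 / real m ^ 4)"
    have "\<delta> > 0" using e m by (simp add: \<delta>_def)
    then obtain Q where Q0: "\<And>z. cmod z = 1 \<Longrightarrow> 0 \<le> Re (poly Q z)" and QI: "Im (poly Q 0) = 0"
      and Q\<delta>: "(\<integral>z. \<bar>\<kappa> n z - Re (poly Q z)\<bar> \<partial>?M) \<le> \<delta>"
      using L1_approx_harmonic_poly[OF \<kappa>_int \<kappa>_le(1)] by metis
    have Q_int: "integrable ?M (\<lambda>z. Re (poly Q z))" using integrable_poly[of Q] by auto
    have d_int: "integrable ?M (\<lambda>z. \<bar>\<kappa> n z - Re (poly Q z)\<bar>)" using \<kappa>_int[of n] Q_int by auto
    have "Re (poly Q 0) = (\<integral>z. Re (poly Q z) \<partial>?M)" by (simp add: integral_Re_poly)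
    also have "\<dots> \<le> (\<integral>z. \<kappa> n z + \<bar>\<kappa> n z - Re (poly Q z)\<bar> \<partial>?M)"
      using Q_int \<kappa>_int[of n] by (intro integral_mono) auto
    also have "\<dots> = (\<integral>z. \<kappa> n z \<partial>?M) + (\<integral>z. \<bar>\<kappa> n z - Re (poly Q z)\<bar> \<partial>?M)"
      by (rule Bochner_Integration.integral_add[OF \<kappa>_int d_int])
    also have "\<dots> \<le> e" using n Q\<delta> by (simp add: \<delta>_def)
    finally have Qe: "Re (poly Q 0) \<le> e" .
    have "(\<integral>z. exp (- 2 * Re (poly Q z)) * inverse (cmod (G z)) ^ (2 * m) \<partial>?M)
        \<le> (\<integral>z. 81 * exp (2 * real n) / real m ^ 4 + 2 * \<bar>\<kappa> n z - Re (poly Q z)\<bar> \<partial>?M)"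
    proof (rule integral_mono_AE')
      show "integrable ?M (\<lambda>z. 81 * exp (2 * real n) / real m ^ 4 + 2 * \<bar>\<kappa> n z - Re (poly Q z)\<bar>)"
        using d_int by auto
      show "AE z in ?M. exp (- 2 * Re (poly Q z)) * inverse (cmod (G z)) ^ (2 * m)
          \<le> 81 * exp (2 * real n) / real m ^ 4 + 2 * \<bar>\<kappa> n z - Re (poly Q z)\<bar>"
        using AE_circle G1
      proof eventually_elim
        fix z assume z: "cmod z = 1" and Gz: "1 < cmod (G z)"
        define t where "t = min 1 (cmod (G z) - 1)"
        have t: "0 < t" "t \<le> 1" "1 + t \<le> cmod (G z)" using Gz by (auto simp: t_def)
        let ?I = "inverse (cmod (G z)) ^ (2 * m)"
        have I: "0 \<le> ?I" "?I \<le> 1" using Gz by (auto intro!: power_le_one simp: inverse_le_1_iff)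
        have "k z = - 2 * ln t" using t by (simp add: k_def t_def[symmetric])
        moreover have "k z - real n \<le> \<kappa> n z" by (simp add: \<kappa>_def)
        ultimately have "- 2 * \<kappa> n z \<le> 2 * real n + 4 * ln t" by linarith
        then have "exp (- 2 * \<kappa> n z) \<le> exp (2 * real n + 4 * ln t)" by simp
        also have "\<dots> = exp (2 * real n) * t ^ 4"
          using t by (simp add: exp_add exp_of_nat_mult[of 4, simplified])
        finally have \<kappa>t: "exp (- 2 * \<kappa> n z) \<le> exp (2 * real n) * t ^ 4" .
        have "exp (- 2 * Re (poly Q z)) * ?I \<le> (exp (- 2 * \<kappa> n z) + 2 * \<bar>\<kappa> n z - Re (poly Q z)\<bar>) * ?I"
          by (intro mult_right_mono exp_minus_le \<kappa>_le Q0 z I)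
        also have "\<dots> \<le> exp (2 * real n) * t ^ 4 * ?I + 2 * \<bar>\<kappa> n z - Re (poly Q z)\<bar> * 1"
          unfolding distrib_right using I by (intro add_mono mult_right_mono mult_left_mono \<kappa>t) auto
        also have "exp (2 * real n) * t ^ 4 * ?I \<le> exp (2 * real n) * (81 / real m ^ 4)"
          unfolding mult.assoc by (intro mult_left_mono quartic_decay t m) auto
        finally show "exp (- 2 * Re (poly Q z)) * ?I
          \<le> 81 * exp (2 * real n) / real m ^ 4 + 2 * \<bar>\<kappa> n z - Re (poly Q z)\<bar>" by (simp add: mult.commute)
      qed
    qed auto
    also have "\<dots> = 81 * exp (2 * real n) / real m ^ 4 + 2 * (\<integral>z. \<bar>\<kappa> n z - Re (poly Q z)\<bar> \<partial>?M)"
      using d_int by (simp add: circle.prob_space[simplified])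
    also have "\<dots> \<le> 81 * exp (2 * real n) / real m ^ 4 + 2 * (1 / real m ^ 4)"
      using Q\<delta> by (simp add: \<delta>_def)
    also have "\<dots> = C / real m ^ 4" by (simp add: C_def add_divide_distrib)
    finally show ?thesis using Q0 QI Qe by blast
  qed
  ultimately show ?thesis by blast
qed

text \<open>For \<open>cmod w \<le> 1\<close> one has
  \<open>cmod (w - 1)^2 \<le> 2 - 2 * Re w\<close>. The mean of \<open>exp (- Q)\<close> is its
  value at the origin, a positive real number, so the norm is controlled by \<open>Q\<close> at the
  origin alone.\<close>

lemma exp_poly_close_to_one:
  assumes Q0: "\<And>z. cmod z = 1 \<Longrightarrow> 0 \<le> Re (poly Q z)" and QI: "Im (poly Q 0) = 0"
  shows "(l2_norm (\<lambda>z. exp (- poly Q z) - 1))\<^sup>2 \<le> 2 * Re (poly Q 0)"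
proof -
  let ?M = circle_measure
  have cont: "continuous_on A (\<lambda>z. exp (- poly Q z))" for A by (intro continuous_intros)
  have [measurable]: "(\<lambda>z. exp (- poly Q z)) \<in> borel_measurable borel"
    by (rule borel_measurable_continuous_onI[OF cont])
  have le1: "cmod (exp (- poly Q z)) \<le> 1" if "cmod z = 1" for z using Q0[OF that] by simp
  have int: "integrable ?M (\<lambda>z. exp (- poly Q z))"
    by (rule integrable_circle_bounded[where B = 1]) (use le1 in auto)
  have "(l2_norm (\<lambda>z. exp (- poly Q z) - 1))\<^sup>2 \<le> (\<integral>z. 2 - 2 * Re (exp (- poly Q z)) \<partial>?M)"
    unfolding l2_norm_square
  proof (rule integral_mono_AE')
    show "integrable ?M (\<lambda>z. 2 - 2 * Re (exp (- poly Q z)))" using int by auto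
    show "AE z in ?M. (cmod (exp (- poly Q z) - 1))\<^sup>2 \<le> 2 - 2 * Re (exp (- poly Q z))"
      using AE_circle
    proof eventually_elim
      fix z :: complex assume "cmod z = 1"
      then have "(cmod (exp (- poly Q z)))\<^sup>2 \<le> 1" using le1[of z] by (simp add: power_le_one)
      moreover have "(cmod (w - 1))\<^sup>2 = (cmod w)\<^sup>2 + 1 - 2 * Re w" for w
        unfolding cmod_power2 by (simp add: power2_eq_square algebra_simps)
      ultimately show "(cmod (exp (- poly Q z) - 1))\<^sup>2 \<le> 2 - 2 * Re (exp (- poly Q z))" by simp
    qed
    show "AE z in ?M. 0 \<le> 2 - 2 * Re (exp (- poly Q z))"
      using AE_circle
    proof eventually_elim
      fix z :: complex assume "cmod z = 1"
      then show "0 \<le> 2 - 2 * Re (exp (- poly Q z))"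
        using complex_Re_le_cmod[of "exp (- poly Q z)"] le1[of z] by linarith
    qed
  qed
  also have "\<dots> = 2 - 2 * Re (\<integral>z. exp (- poly Q z) \<partial>?M)"
    using int integral_Re[OF int] by (simp add: circle.prob_space[simplified])
  also have "(\<integral>z. exp (- poly Q z) \<partial>?M) = exp (- poly Q 0)"
    by (rule mean_value_circle_measure) (auto intro!: holomorphic_intros cont)
  also have "Re (exp (- poly Q 0)) = exp (- Re (poly Q 0))"
    using QI by (simp add: Re_exp)
  also have "2 - 2 * exp (- Re (poly Q 0)) \<le> 2 * Re (poly Q 0)"
    using exp_ge_add_one_self[of "- Re (poly Q 0)"] by simp
  finally show ?thesis .
qed

section \<open>Bang's lemma\<close>

text \<open>
  Bang's argument: signs maximising the quadratic form \<open>\<Sum>i j. e\<^sub>i e\<^sub>j w\<^sub>i w\<^sub>j a\<^sub>i\<^sub>j\<close> work, because flipping a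
  single sign does not increase it.
\<close>

lemma bang_signs_finite:
  fixes a :: "nat \<Rightarrow> nat \<Rightarrow> real" and w :: "nat \<Rightarrow> real"
  assumes sym: "\<And>j k. a j k = a k j" and diag: "\<And>k. a k k = 1" and w: "\<And>k. w k > 0"
  shows "\<exists>e. (\<forall>j. \<bar>e j\<bar> \<le> 1) \<and> (\<forall>k<n. w k \<le> \<bar>\<Sum>j<n. e j * w j * a j k\<bar>)"
proof -
  define S where "S = {..<n} \<rightarrow>\<^sub>E {-1, 1::real}"
  define q where "q = (\<lambda>e. \<Sum>i<n. \<Sum>j<n. (e i * w i) * (e j * w j) * a i j)"
  have "finite S" "S \<noteq> {}"
    unfolding S_def by (auto intro: finite_PiE simp: PiE_eq_empty_iff)
  then obtain e where e: "e \<in> S" and emax: "\<And>e'. e' \<in> S \<Longrightarrow> q e' \<le> q e"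
    using Max_in[of "q ` S"] Max_ge[of "q ` S"]
    by (metis (no_types, lifting) finite_imageI image_is_empty imageE imageI)
  have e1: "e j = -1 \<or> e j = 1" if "j < n" for j
    using e that unfolding S_def by (auto simp: PiE_iff)
  have main: "w k \<le> \<bar>\<Sum>j<n. e j * w j * a j k\<bar>" if k: "k < n" for k
  proof -
    define e' where "e' = e(k := - e k)"
    define r where "r = (\<Sum>j\<in>{..<n}-{k}. e j * w j * a j k)"
    have split: "q f = (\<Sum>i\<in>{..<n}-{k}. \<Sum>j\<in>{..<n}-{k}. (f i * w i) * (f j * w j) * a i j)
        + 2 * (f k * w k) * (\<Sum>j\<in>{..<n}-{k}. f j * w j * a j k) + (f k * w k)\<^sup>2" for f
    proof -
      have "q f = (\<Sum>j<n. (f k * w k) * (f j * w j) * a k j)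
           + (\<Sum>i\<in>{..<n}-{k}. \<Sum>j<n. (f i * w i) * (f j * w j) * a i j)"
        unfolding q_def using k by (subst sum.remove[of _ k]) auto
      also have "(\<Sum>j<n. (f k * w k) * (f j * w j) * a k j)
          = (f k * w k)\<^sup>2 + (f k * w k) * (\<Sum>j\<in>{..<n}-{k}. f j * w j * a j k)"
        using k by (subst sum.remove[of _ k])
          (auto simp: diag power2_eq_square sum_distrib_left sym[of k] mult.assoc)
      also have "(\<Sum>i\<in>{..<n}-{k}. \<Sum>j<n. (f i * w i) * (f j * w j) * a i j)
          = (\<Sum>i\<in>{..<n}-{k}. (f i * w i) * (f k * w k) * a i k
              + (\<Sum>j\<in>{..<n}-{k}. (f i * w i) * (f j * w j) * a i j))"
        using k by (intro sum.cong refl, subst sum.remove[of _ k]) auto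
      also have "\<dots> = (f k * w k) * (\<Sum>j\<in>{..<n}-{k}. f j * w j * a j k)
          + (\<Sum>i\<in>{..<n}-{k}. \<Sum>j\<in>{..<n}-{k}. (f i * w i) * (f j * w j) * a i j)"
        by (simp add: sum.distrib sum_distrib_left mult_ac)
      finally show ?thesis by simp
    qed
    have "e' \<in> S"
      using e k e1[OF k] unfolding S_def e'_def by (auto simp: PiE_iff extensional_def)
    then have "q e' \<le> q e" by (rule emax)
    moreover have "q e' = (\<Sum>i\<in>{..<n}-{k}. \<Sum>j\<in>{..<n}-{k}. (e i * w i) * (e j * w j) * a i j)
        - 2 * (e k * w k) * r + (e k * w k)\<^sup>2"
      unfolding split r_def e'_def by (auto intro!: sum.cong)
    \<comment> \<open>Flipping the sign at \<open>k\<close> changes only the cross term, so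
      maximality makes \<open>e k * r\<close> nonnegative. Then \<open>e k * w k\<close> and
      \<open>r\<close> cannot cancel, and their sum has modulus at least \<open>w k\<close>.\<close>
    ultimately have "0 \<le> (e k * r) * w k"
      using split[of e] by (simp add: r_def mult_ac)
    then have "0 \<le> e k * r"
      using w[of k] by (simp add: zero_le_mult_iff)
    moreover have "(\<Sum>j<n. e j * w j * a j k) = e k * w k + r"
      unfolding r_def using k by (subst sum.remove[of _ k]) (auto simp: diag)
    ultimately show ?thesis
      using e1[OF k] w[of k] by auto
  qed
  show ?thesis
  \<comment> \<open>Values beyond \<open>n\<close> are set to zero, so that the bound by 1 holds for
    every index, as the compactness argument requires.\<close>
  proof (intro exI[of _ "\<lambda>j. if j < n then e j else 0"] conjI allI impI)
    show "\<bar>if j < n then e j else 0\<bar> \<le> 1" for j using e1[of j] by auto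
    fix k assume k: "k < n"
    have "(\<Sum>j<n. (if j < n then e j else 0) * w j * a j k) = (\<Sum>j<n. e j * w j * a j k)"
      by (intro sum.cong) auto
    then show "w k \<le> \<bar>\<Sum>j<n. (if j < n then e j else 0) * w j * a j k\<bar>"
      using main[OF k] by simp
  qed
qed

text \<open>A diagonal subsequence of the finite sign choices converges in every coordinate;
  summability of \<open>w\<close> dominates the sums, so Tannery's theorem carries each inequality
  to the limit.\<close>

lemma bang_signs:
  fixes a :: "nat \<Rightarrow> nat \<Rightarrow> real" and w :: "nat \<Rightarrow> real"
  assumes sym: "\<And>j k. a j k = a k j" and diag: "\<And>k. a k k = 1" and bnd: "\<And>j k. \<bar>a j k\<bar> \<le> 1"
    and w: "\<And>k. w k > 0" and sw: "summable w"
  shows "\<exists>e. (\<forall>j. \<bar>e j\<bar> \<le> 1) \<and> (\<forall>k. w k \<le> \<bar>\<Sum>j. e j * w j * a j k\<bar>)"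
proof -
  obtain E where E1: "\<And>n j. \<bar>E n j\<bar> \<le> 1"
    and E2: "\<And>n k. k < n \<Longrightarrow> w k \<le> \<bar>\<Sum>j<n. E n j * w j * a j k\<bar>"
    using bang_signs_finite[of a w, OF sym diag w] by metis
  obtain s where s: "strict_mono (s::nat\<Rightarrow>nat)"
    and ex: "\<And>j. j \<in> UNIV \<Longrightarrow> \<exists>l. (\<lambda>n. E (s n) j) \<longlonglongrightarrow> l"
    by (rule function_convergent_subsequence[of "UNIV::nat set" E 1]) (use E1 in auto)
  define e where "e = (\<lambda>j. lim (\<lambda>n. E (s n) j))"
  have e: "(\<lambda>n. E (s n) j) \<longlonglongrightarrow> e j" for j
    using ex[of j] unfolding e_def by (simp add: convergent_LIMSEQ_iff[symmetric] convergent_def)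
  have e1: "\<bar>e j\<bar> \<le> 1" for j
    by (rule LIMSEQ_le_const2[OF tendsto_rabs[OF e[of j]]]) (use E1 in auto)
  have "w k \<le> \<bar>\<Sum>j. e j * w j * a j k\<bar>" for k
  proof -
    define b where "b = (\<lambda>j n. (if j < s n then E (s n) j * w j * a j k else 0))"
    have le: "\<bar>b j n\<bar> \<le> w j" for j n
    proof -
      have "\<bar>E (s n) j * w j * a j k\<bar> \<le> 1 * w j * 1"
        unfolding abs_mult using E1[of "s n" j] bnd[of j k] w[of j] by (intro mult_mono) auto
      then show ?thesis using w[of j] by (auto simp: b_def)
    qed
    have lim: "(\<lambda>n. b j n) \<longlonglongrightarrow> e j * w j * a j k" for j
    proof (rule Lim_transform_eventually)
      show "(\<lambda>n. E (s n) j * w j * a j k) \<longlonglongrightarrow> e j * w j * a j k"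
        by (intro tendsto_intros e)
      have "j < s n" if "Suc j \<le> n" for n
        using seq_suble[OF s, of n] that by simp
      then show "\<forall>\<^sub>F n in sequentially. E (s n) j * w j * a j k = b j n"
        unfolding eventually_sequentially b_def by (intro exI[of _ "Suc j"]) auto
    qed
    have "(\<lambda>n. \<Sum>j. b j n) \<longlonglongrightarrow> (\<Sum>j. e j * w j * a j k)"
    proof -
      have ev: "\<forall>\<^sub>F (j, n) in sequentially \<times>\<^sub>F sequentially. norm (b j n) \<le> w j"
        by (intro always_eventually) (auto simp: le)
      show ?thesis
        using tannerys_theorem[of b "\<lambda>j. e j * w j * a j k" sequentially w, OF lim ev sw] by simp
    qed
    moreover have "(\<Sum>j. b j n) = (\<Sum>j<s n. E (s n) j * w j * a j k)" for n
      by (subst suminf_finite[of "{..<s n}"]) (auto simp: b_def)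
    ultimately have "(\<lambda>n. \<bar>\<Sum>j<s n. E (s n) j * w j * a j k\<bar>) \<longlonglongrightarrow> \<bar>\<Sum>j. e j * w j * a j k\<bar>"
      by (simp add: tendsto_rabs)
    moreover have "w k \<le> \<bar>\<Sum>j<s n. E (s n) j * w j * a j k\<bar>" if "Suc k \<le> n" for n
      using seq_suble[OF s, of n] that by (intro E2) simp
    ultimately show ?thesis
      by (intro LIMSEQ_le_const) auto
  qed
  with e1 show ?thesis by blast
qed

section \<open>Orbits of the adjoint\<close>

lemma H2_cmult: "f \<in> H2 \<Longrightarrow> (\<lambda>z. c * f z) \<in> H2"
  unfolding H2_iff_moments by (auto intro: L2T_cmult simp: mult.assoc)

lemma l2_norm_cmult: "l2_norm (\<lambda>z. c * f z) = cmod c * l2_norm f"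
  unfolding l2_norm_def by (simp add: norm_mult power_mult_distrib real_sqrt_mult)

lemma one_in_H2: "(\<lambda>_. 1) \<in> H2"
  unfolding H2_iff_moments
proof (intro conjI allI impI one_in_L2T)
  fix n :: nat assume "n \<ge> 1"
  have "(\<integral>z. z ^ n \<partial>circle_measure) = 0 ^ n"
    by (rule mean_value_circle_measure)
      (auto intro!: continuous_intros holomorphic_intros borel_measurable_continuous_onI)
  then show "(\<integral>z. 1 * z ^ n \<partial>circle_measure) = 0" using \<open>n \<ge> 1\<close> by simp
qed

lemma functional_of_l2_series:
  assumes e: "\<And>j. e j \<in> H2" "\<And>j. l2_norm (e j) \<le> 1" and s: "summable (\<lambda>j. \<bar>s j\<bar>)"
  shows "cont_lin_functional_H2 (\<lambda>y. \<Sum>j. of_real (s j) * l2_inner y (e j))"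
    and "\<And>y. y \<in> H2 \<Longrightarrow> summable (\<lambda>j. of_real (s j) * l2_inner y (e j))"
proof -
  define \<phi> where "\<phi> = (\<lambda>y. \<Sum>j. of_real (s j) * l2_inner y (e j))"
  have eL: "e j \<in> L2T" for j using e(1) by (rule H2_L2T)
  have term_le: "cmod (of_real (s j) * l2_inner y (e j)) \<le> \<bar>s j\<bar> * l2_norm y" if "y \<in> L2T" for y j
  proof -
    have "cmod (l2_inner y (e j)) \<le> l2_norm y * l2_norm (e j)"
      by (rule l2_Cauchy_Schwarz[OF that eL])
    also have "\<dots> \<le> l2_norm y * 1" by (intro mult_left_mono e) simp
    finally show ?thesis by (simp add: norm_mult mult_left_mono)
  qed
  have sn: "summable (\<lambda>j. \<bar>s j\<bar> * l2_norm y)" for y using s by (rule summable_mult2)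
  have sm: "summable (\<lambda>j. of_real (s j) * l2_inner y (e j))" if "y \<in> L2T" for y
    by (rule summable_comparison_test'[OF sn[of y], of 0]) (use term_le[OF that] in auto)
  then show "\<And>y. y \<in> H2 \<Longrightarrow> summable (\<lambda>j. of_real (s j) * l2_inner y (e j))" by (auto dest: H2_L2T)
  have bound: "cmod (\<phi> y) \<le> (\<Sum>j. \<bar>s j\<bar>) * l2_norm y" if "y \<in> L2T" for y
  proof -
    have "cmod (\<phi> y) \<le> (\<Sum>j. \<bar>s j\<bar> * l2_norm y)"
      unfolding \<phi>_def by (rule norm_suminf_le[OF term_le[OF that] sn])
    also have "\<dots> = (\<Sum>j. \<bar>s j\<bar>) * l2_norm y" by (rule suminf_mult2[OF s, symmetric])
    finally show ?thesis .
  qed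
  have diff: "\<phi> h - \<phi> f = \<phi> (\<lambda>z. h z - f z)" if "f \<in> L2T" "h \<in> L2T" for f h
    unfolding \<phi>_def using that
    by (simp add: suminf_diff[OF sm sm] l2_inner_diff eL right_diff_distrib)
  have "cont_lin_functional_H2 \<phi>"
    unfolding cont_lin_functional_H2_def
  proof (intro conjI ballI allI impI)
    fix f h assume f: "f \<in> H2" and h: "h \<in> H2"
    show "\<phi> (\<lambda>z. f z + h z) = \<phi> f + \<phi> h"
      unfolding \<phi>_def using H2_L2T[OF f] H2_L2T[OF h]
      by (simp add: suminf_add[OF sm sm] l2_inner_add eL distrib_left)
  next
    fix f c assume f: "f \<in> H2"
    show "\<phi> (\<lambda>z. c * f z) = c * \<phi> f"
      unfolding \<phi>_def l2_inner_cmult using suminf_mult[OF sm[OF H2_L2T[OF f]], of c] by (simp add: mult_ac)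
  next
    fix f and eps :: real assume f: "f \<in> H2" and eps: "eps > 0"
    define S where "S = (\<Sum>j. \<bar>s j\<bar>)"
    have S: "0 \<le> S" unfolding S_def by (rule suminf_nonneg[OF s]) simp
    show "\<exists>d>0. \<forall>h\<in>H2. l2_norm (\<lambda>z. h z - f z) < d \<longrightarrow> cmod (\<phi> h - \<phi> f) < eps"
    proof (intro exI[of _ "eps / (S + 1)"] conjI ballI impI)
      show "0 < eps / (S + 1)" using S eps by simp
      fix h assume h: "h \<in> H2" and lt: "l2_norm (\<lambda>z. h z - f z) < eps / (S + 1)"
      have "cmod (\<phi> h - \<phi> f) \<le> S * l2_norm (\<lambda>z. h z - f z)"
        unfolding diff[OF H2_L2T[OF f] H2_L2T[OF h]] S_def
        by (intro bound L2T_diff H2_L2T f h)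
      also have "\<dots> \<le> (S + 1) * l2_norm (\<lambda>z. h z - f z)" by (intro mult_right_mono) auto
      also have "\<dots> < eps" using lt S by (simp add: pos_less_divide_eq mult.commute)
      finally show "cmod (\<phi> h - \<phi> f) < eps" .
    qed
  qed
  then show "cont_lin_functional_H2 (\<lambda>y. \<Sum>j. of_real (s j) * l2_inner y (e j))"
    by (simp only: \<phi>_def)
qed

text \<open>Bang's lemma gives a value of modulus at least \<open>w m\<close> at the normalised
  vector \<open>e m\<close>; multiplying by the norm of \<open>y m\<close>, at least
  \<open>c / w m\<close>, yields \<open>c\<close>.\<close>

lemma functional_bounded_below_on_orbit:
  assumes y: "\<And>m. y m \<in> H2" and c: "c > 0" and grow: "\<And>m. c * (real m + 1)\<^sup>2 \<le> l2_norm (y m)"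
  obtains \<phi> where "cont_lin_functional_H2 \<phi>" "\<And>m. c \<le> cmod (\<phi> (y m))"
proof -
  define w where "w = (\<lambda>m::nat. 1 / (real m + 1)\<^sup>2)"
  have w: "w m > 0" for m by (simp add: w_def add_nonneg_eq_0_iff)
  have sw: "summable w"
  proof -
    have "summable (\<lambda>n. inverse (real (Suc n) ^ 2))"
      using inverse_power_summable[of 2, where ?'a = real] by (subst summable_Suc_iff) simp
    then show ?thesis by (simp add: w_def inverse_eq_divide add.commute)
  qed
  have pos: "0 < l2_norm (y m)" for m
    by (rule less_le_trans[OF _ grow]) (use c in \<open>simp add: add_nonneg_eq_0_iff\<close>)
  define e where "e = (\<lambda>m z. of_real (1 / l2_norm (y m)) * y m z)"
  have eH: "e m \<in> H2" for m unfolding e_def by (rule H2_cmult[OF y])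
  have en: "l2_norm (e m) = 1" for m
    unfolding e_def l2_norm_cmult using pos[of m] by (simp add: norm_divide)
  \<comment> \<open>Bang's lemma is about real Gram matrices. Taking real parts suffices, because
    only a lower bound for a modulus is wanted and \<open>Re\<close> does not exceed it.\<close>
  define a where "a = (\<lambda>j k. Re (l2_inner (e k) (e j)))"
  obtain s where s1: "\<And>j. \<bar>s j\<bar> \<le> 1" and s2: "\<And>k. w k \<le> \<bar>\<Sum>j. s j * w j * a j k\<bar>"
  proof -
    have "\<exists>s. (\<forall>j. \<bar>s j\<bar> \<le> 1) \<and> (\<forall>k. w k \<le> \<bar>\<Sum>j. s j * w j * a j k\<bar>)"
    proof (rule bang_signs[OF _ _ _ w sw])
      show "a j k = a k j" for j k
        unfolding a_def using l2_inner_commute[of "e k" "e j"] by simp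
      show "a k k = 1" for k unfolding a_def l2_inner_self en by simp
      show "\<bar>a j k\<bar> \<le> 1" for j k
        using abs_Re_le_cmod[of "l2_inner (e k) (e j)"] l2_Cauchy_Schwarz[of "e k" "e j"] eH en
        unfolding a_def by (simp add: H2_L2T)
    qed
    then show ?thesis using that by blast
  qed
  define \<phi> where "\<phi> = (\<lambda>f. \<Sum>j. complex_of_real (s j * w j) * l2_inner f (e j))"
  have sabs: "summable (\<lambda>j. \<bar>s j * w j\<bar>)"
  proof (rule summable_comparison_test'[OF sw, of 0])
    show "norm \<bar>s j * w j\<bar> \<le> w j" for j
      using s1[of j] w[of j] by (simp add: abs_mult mult_left_le_one_le)
  qed
  have "cont_lin_functional_H2 \<phi>"
    unfolding \<phi>_def by (rule functional_of_l2_series(1)[OF eH _ sabs]) (simp add: en)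
  moreover have "c \<le> cmod (\<phi> (y m))" for m
  proof -
    have sm: "summable (\<lambda>j. complex_of_real (s j * w j) * l2_inner (e m) (e j))"
      by (rule functional_of_l2_series(2)[OF eH _ sabs eH]) (simp add: en)
    have "Re (\<phi> (e m)) = (\<Sum>j. s j * w j * a j m)"
      unfolding \<phi>_def Re_suminf[OF sm] a_def by simp
    then have we: "w m \<le> cmod (\<phi> (e m))"
      using s2[of m] abs_Re_le_cmod[of "\<phi> (e m)"] by simp
    have "\<phi> (e m) = of_real (1 / l2_norm (y m)) * \<phi> (y m)"
      using \<open>cont_lin_functional_H2 \<phi>\<close> y[of m] unfolding cont_lin_functional_H2_def e_def by blast
    then have "cmod (\<phi> (y m)) = l2_norm (y m) * cmod (\<phi> (e m))"
      using pos[of m] by (simp add: norm_divide norm_mult)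
    also have "\<dots> \<ge> (c * (real m + 1)\<^sup>2) * w m"
      by (intro mult_mono grow we) (use w[of m] in auto)
    also have "(c * (real m + 1)\<^sup>2) * w m = c" by (simp add: w_def add_nonneg_eq_0_iff)
    finally show ?thesis .
  qed
  ultimately show ?thesis using that by blast
qed

lemma adjoint_orbit_growth:
  fixes g :: "complex \<Rightarrow> complex" and A :: "(complex \<Rightarrow> complex) \<Rightarrow> complex \<Rightarrow> complex"
  assumes hol: "g holomorphic_on ball 0 1" and ge: "\<And>z. cmod z < 1 \<Longrightarrow> 1 \<le> cmod (g z)"
    and G_meas [measurable]: "G \<in> borel_measurable borel"
    and G: "AE z in circle_measure. (\<lambda>n. g (of_real (rad n) * z)) \<longlonglongrightarrow> G z"
    and G1: "AE z in circle_measure. 1 < cmod (G z)"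
    and log: "integrable circle_measure (\<lambda>z. ln (cmod (G z) - 1))"
    and A: "\<And>y. y \<in> H2 \<Longrightarrow> A y \<in> H2"
    and adj: "\<And>f y. f \<in> H2 \<Longrightarrow> y \<in> H2 \<Longrightarrow> (\<lambda>z. G z * f z) \<in> L2T \<Longrightarrow> l2_inner f (A y) = l2_inner (\<lambda>z. G z * f z) y"
    and x: "x \<in> H2" and nz: "l2_norm x \<noteq> 0"
  shows "\<exists>c>0. \<forall>m. c * (real m + 1)\<^sup>2 \<le> l2_norm ((A ^^ m) x)"
proof -
  let ?M = circle_measure
  have orbit: "(A ^^ m) x \<in> H2" for m by (induction m) (auto intro: A x)
  have npos: "0 < l2_norm x" using nz l2_norm_nonneg[of x] by linarith
  obtain j where j: "l2_inner (\<lambda>z. z ^ j) x \<noteq> 0" using H2_nonzero_coefficient[OF x nz] by blast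
  define b where "b = cmod (l2_inner (\<lambda>z. z ^ j) x)"
  have b: "b > 0" using j by (simp add: b_def)
  \<comment> \<open>Chosen so that \<open>sqrt (2 * eps)\<close> is
    \<open>b / (2 * l2_norm x)\<close>: replacing \<open>z^j\<close> by
    \<open>exp (- Q) * z^j\<close> then changes the pairing with \<open>x\<close> by at most
    \<open>b / 2\<close>, and half of it survives.\<close>
  define eps where "eps = (b / (2 * l2_norm x))\<^sup>2 / 2"
  have eps: "eps > 0" using b npos by (simp add: eps_def)
  obtain C where C: "C \<ge> 0" and CQ: "\<And>m. m \<ge> 1 \<Longrightarrow> \<exists>Q. (\<forall>z. cmod z = 1 \<longrightarrow> 0 \<le> Re (poly Q z)) \<and>
      Im (poly Q 0) = 0 \<and> Re (poly Q 0) \<le> eps \<and>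
      (\<integral>z. exp (- 2 * Re (poly Q z)) * inverse (cmod (G z)) ^ (2 * m) \<partial>?M) \<le> C / real m ^ 4"
    using small_mean_multiplier[OF G_meas G1 log eps] by blast
  \<comment> \<open>\<open>D^2\<close> dominates \<open>C\<close>, and the added 1 keeps
    \<open>D\<close> positive even for \<open>C = 0\<close>.\<close>
  define D where "D = sqrt C + 1"
  have D: "D > 0" using C by (simp add: D_def add_nonneg_pos)
  have grow: "b / 2 * (real m)\<^sup>2 \<le> D * l2_norm ((A ^^ m) x)" if m: "m \<ge> 1" for m
  proof -
    obtain Q where Q0: "\<And>z. cmod z = 1 \<Longrightarrow> 0 \<le> Re (poly Q z)" and QI: "Im (poly Q 0) = 0"
      and Qe: "Re (poly Q 0) \<le> eps"
      and Qint: "(\<integral>z. exp (- 2 * Re (poly Q z)) * inverse (cmod (G z)) ^ (2 * m) \<partial>?M) \<le> C / real m ^ 4"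
      using CQ[OF m] by blast
    define u where "u = (\<lambda>z. exp (- poly Q z) * z ^ j)"
    have u_hol: "u holomorphic_on UNIV" unfolding u_def by (intro holomorphic_intros)
    define f where "f = (\<lambda>i z. u z * inverse (G z) ^ i)"
    have fH: "f i \<in> H2" for i
      unfolding f_def by (rule entire_times_inverse_power_H2[OF hol ge G_meas G G1 u_hol])
    have f_meas [measurable]: "f i \<in> borel_measurable borel" for i
      using fH by (intro L2T_measurable H2_L2T)
    \<comment> \<open>Multiplication by \<open>G\<close> removes one factor \<open>1 / G\<close>.
      Hence \<open>G * f (Suc i)\<close> is square integrable, as \<open>adj\<close> demands, and
      each application of \<open>A\<close> lowers the index by one until only \<open>u\<close> is
      left.\<close>
    have Gf: "AE z in ?M. G z * f (Suc i) z = f i z" for i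
      using G1
    proof eventually_elim
      case (elim z)
      then have "G z \<noteq> 0" by auto
      then show ?case by (simp add: f_def)
    qed
    have GfL: "(\<lambda>z. G z * f (Suc i) z) \<in> L2T" for i
    proof -
      have "integrable ?M (\<lambda>z. (cmod (G z * f (Suc i) z))\<^sup>2) \<longleftrightarrow> integrable ?M (\<lambda>z. (cmod (f i z))\<^sup>2)"
        by (rule integrable_cong_AE) (use Gf[of i] in \<open>auto elim!: eventually_mono\<close>)
      then show ?thesis using H2_L2T[OF fH[of i]] unfolding L2T_def by simp
    qed
    have shift: "l2_inner (f (Suc i)) (A y) = l2_inner (f i) y" if y: "y \<in> H2" for i y
    proof -
      have [measurable]: "y \<in> borel_measurable borel" using y by (intro L2T_measurable H2_L2T)
      have "l2_inner (f (Suc i)) (A y) = l2_inner (\<lambda>z. G z * f (Suc i) z) y"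
        by (rule adj[OF fH y GfL])
      also have "\<dots> = l2_inner (f i) y"
        unfolding l2_inner_def by (rule integral_cong_AE) (use Gf[of i] in \<open>auto elim!: eventually_mono\<close>)
      finally show ?thesis .
    qed
    have pull: "l2_inner (f i) ((A ^^ i) x) = l2_inner u x" for i
    proof (induction i)
      case 0 show ?case by (simp add: f_def)
    next
      case (Suc i)
      then show ?case using shift[OF orbit[of i], of i] by simp
    qed
    have u_meas [measurable]: "u \<in> borel_measurable borel"
      by (rule borel_measurable_continuous_onI[OF holomorphic_on_imp_continuous_on[OF u_hol]])
    have zj: "(\<lambda>z. z ^ j) \<in> L2T"
      by (rule bounded_in_L2T[where B = 1]) (use AE_circle in \<open>auto simp: norm_power elim!: eventually_mono\<close>)
    have uL: "u \<in> L2T" using H2_L2T[OF fH[of 0]] by (simp add: f_def)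
    have "b \<le> cmod (l2_inner u x) + b / 2"
    proof -
      have "cmod (l2_inner (\<lambda>z. u z - z ^ j) x) \<le> l2_norm (\<lambda>z. u z - z ^ j) * l2_norm x"
        by (intro l2_Cauchy_Schwarz L2T_diff uL zj H2_L2T x)
      also have "l2_norm (\<lambda>z. u z - z ^ j) = l2_norm (\<lambda>z. exp (- poly Q z) - 1)"
      proof -
        have [measurable]: "(\<lambda>z. exp (- poly Q z)) \<in> borel_measurable borel"
          by (intro borel_measurable_continuous_onI continuous_intros)
        have "(\<integral>z. (cmod (u z - z ^ j))\<^sup>2 \<partial>?M) = (\<integral>z. (cmod (exp (- poly Q z) - 1))\<^sup>2 \<partial>?M)"
        proof (rule integral_cong_AE)
          show "AE z in ?M. (cmod (u z - z ^ j))\<^sup>2 = (cmod (exp (- poly Q z) - 1))\<^sup>2"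
            using AE_circle
          proof eventually_elim
            fix z :: complex assume z: "cmod z = 1"
            have "u z - z ^ j = (exp (- poly Q z) - 1) * z ^ j" by (simp add: u_def algebra_simps)
            then show "(cmod (u z - z ^ j))\<^sup>2 = (cmod (exp (- poly Q z) - 1))\<^sup>2"
              using z by (simp add: norm_mult norm_power)
          qed
        qed measurable
        then show ?thesis by (simp add: l2_norm_def)
      qed
      also have "\<dots> \<le> b / (2 * l2_norm x)"
      proof (rule power2_le_imp_le)
        have "(l2_norm (\<lambda>z. exp (- poly Q z) - 1))\<^sup>2 \<le> 2 * Re (poly Q 0)"
          by (rule exp_poly_close_to_one[OF Q0 QI])
        also have "\<dots> \<le> 2 * eps" using Qe by simp
        also have "\<dots> = (b / (2 * l2_norm x))\<^sup>2" by (simp add: eps_def)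
        finally show "(l2_norm (\<lambda>z. exp (- poly Q z) - 1))\<^sup>2 \<le> (b / (2 * l2_norm x))\<^sup>2" .
        show "0 \<le> b / (2 * l2_norm x)" using b npos by simp
      qed
      finally have "cmod (l2_inner (\<lambda>z. u z - z ^ j) x) \<le> b / (2 * l2_norm x) * l2_norm x"
        by (simp add: mult_right_mono)
      also have "\<dots> = b / 2" using npos by simp
      finally have small: "cmod (l2_inner u x - l2_inner (\<lambda>z. z ^ j) x) \<le> b / 2"
        by (simp add: l2_inner_diff[OF uL zj H2_L2T[OF x]])
      have "b \<le> cmod (l2_inner u x) + cmod (l2_inner u x - l2_inner (\<lambda>z. z ^ j) x)"
        unfolding b_def using norm_triangle_ineq4[of "l2_inner u x" "l2_inner u x - l2_inner (\<lambda>z. z ^ j) x"] by simp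
      with small show ?thesis by simp
    qed
    then have "b / 2 \<le> cmod (l2_inner (f m) ((A ^^ m) x))" by (simp add: pull)
    also have "\<dots> \<le> l2_norm (f m) * l2_norm ((A ^^ m) x)"
      by (intro l2_Cauchy_Schwarz H2_L2T fH orbit)
    also have "l2_norm (f m) \<le> D / (real m)\<^sup>2"
    proof -
      have "(l2_norm (f m))\<^sup>2 = (\<integral>z. exp (- 2 * Re (poly Q z)) * inverse (cmod (G z)) ^ (2 * m) \<partial>?M)"
        unfolding l2_norm_square
      proof (rule integral_cong_AE)
        show "AE z in ?M. (cmod (f m z))\<^sup>2 = exp (- 2 * Re (poly Q z)) * inverse (cmod (G z)) ^ (2 * m)"
          using AE_circle
        proof eventually_elim
          fix z :: complex assume z: "cmod z = 1"
          have "(exp (- Re (poly Q z)))\<^sup>2 = exp (- 2 * Re (poly Q z))"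
            by (simp add: power2_eq_square exp_add[symmetric])
          then show "(cmod (f m z))\<^sup>2 = exp (- 2 * Re (poly Q z)) * inverse (cmod (G z)) ^ (2 * m)"
            using z by (simp add: f_def u_def norm_mult norm_power norm_inverse power_mult_distrib power_mult[symmetric] mult.commute)
        qed
      qed measurable
      also have "\<dots> \<le> C / real m ^ 4" by (rule Qint)
      also have "\<dots> \<le> (D / (real m)\<^sup>2)\<^sup>2"
      proof -
        have "C \<le> D\<^sup>2" using C by (simp add: D_def power2_sum)
        then show ?thesis by (simp add: power_divide power_mult[symmetric] divide_right_mono)
      qed
      finally show ?thesis by (rule power2_le_imp_le) (use D in simp)
    qed
    finally have "b / 2 \<le> D / (real m)\<^sup>2 * l2_norm ((A ^^ m) x)" by (simp add: mult_right_mono)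
    then show ?thesis using m by (simp add: field_simps)
  qed
  \<comment> \<open>The first entry serves \<open>m = 0\<close>; for \<open>m \<ge> 1\<close>,
    \<open>(m + 1)^2 \<le> 4 * m^2\<close> turns the rate \<open>b / (2 * D)\<close> into
    \<open>b / (8 * D)\<close>.\<close>
  define c where "c = min (l2_norm x) (b / (8 * D))"
  have "c > 0" using b D npos by (simp add: c_def)
  moreover have "c * (real m + 1)\<^sup>2 \<le> l2_norm ((A ^^ m) x)" for m
  proof (cases "m = 0")
    case True then show ?thesis by (simp add: c_def)
  next
    case False
    then have m: "m \<ge> 1" by simp
    have "(real m + 1)\<^sup>2 \<le> (2 * real m)\<^sup>2" using m by (intro power_mono) auto
    then have "c * (real m + 1)\<^sup>2 \<le> b / (8 * D) * (4 * (real m)\<^sup>2)"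
      using b D by (intro mult_mono) (auto simp: c_def power_mult_distrib)
    also have "\<dots> = (b / 2 * (real m)\<^sup>2) / D" by simp
    also have "\<dots> \<le> l2_norm ((A ^^ m) x)" using grow[OF m] D by (simp add: pos_divide_le_eq mult_ac)
    finally show ?thesis .
  qed
  ultimately show ?thesis by blast
qed

theorem theorem1p10:
  fixes g :: "complex \<Rightarrow> complex"
    and Tg A :: "(complex \<Rightarrow> complex) \<Rightarrow> (complex \<Rightarrow> complex)"
  assumes g_Hinf: "g \<in> Hinfty"
    and g_disk: "\<forall>z\<in>ball 0 1. g z \<notin> ball 0 1"
    and g_bd: "AE z in circle_measure. cmod (boundary_value g z) > 1"
    and g_log: "integrable circle_measure (\<lambda>z. ln (cmod (boundary_value g z) - 1))"
    and Tg_maps: "\<forall>f\<in>H2. Tg f \<in> H2"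
    and Tg_proj: "\<forall>f\<in>H2. \<forall>h\<in>H2.
                    l2_inner (\<lambda>z. boundary_value g z * f z - Tg f z) h = 0"
    and A_maps: "\<forall>h\<in>H2. A h \<in> H2"
    and A_adj: "\<forall>f\<in>H2. \<forall>h\<in>H2. l2_inner (Tg f) h = l2_inner f (A h)"
  shows "\<not> one_weakly_hypercyclic_H2 A"
proof
  let ?M = circle_measure
  assume "one_weakly_hypercyclic_H2 A"
  then obtain x where x: "x \<in> H2"
    and dense: "\<And>\<phi> f. cont_lin_functional_H2 \<phi> \<Longrightarrow> f \<in> H2 \<Longrightarrow> \<phi> f \<noteq> 0 \<Longrightarrow>
      closure (range (\<lambda>m::nat. \<phi> ((A ^^ m) x))) = UNIV"
    unfolding one_weakly_hypercyclic_H2_def by blast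
  have orbit: "(A ^^ m) x \<in> H2" for m by (induction m) (use A_maps x in auto)
  show False
  proof (cases "l2_norm x = 0")
    case True
    \<comment> \<open>Operators act on functions, not on classes modulo null sets, so nothing says
      directly that \<open>A\<close> maps a null function to a null function. The adjoint relation
      shows instead that the whole orbit is orthogonal to \<open>H2\<close>.\<close>
    have zero: "l2_inner f ((A ^^ m) x) = 0" if "f \<in> H2" for f m
      using that
    proof (induction m arbitrary: f)
      case 0
      then show ?case using l2_Cauchy_Schwarz[of f x] True x by (simp add: H2_L2T)
    next
      case (Suc m)
      then show ?case
        using A_adj[rule_format, OF Suc.prems orbit[of m]] Suc.IH[of "Tg f"] Tg_maps by simp
    qed
    \<comment> \<open>The mean over the circle, written as a one-term series so that continuity
      follows from \<open>functional_of_l2_series\<close>.\<close>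
    define \<phi> where "\<phi> = (\<lambda>y. \<Sum>j. complex_of_real (if j = (0::nat) then 1 else 0) * l2_inner y (\<lambda>_. 1))"
    have \<phi>: "\<phi> y = l2_inner y (\<lambda>_. 1)" for y
      unfolding \<phi>_def by (subst suminf_finite[of "{0}"]) auto
    have "cont_lin_functional_H2 \<phi>"
      unfolding \<phi>_def
      by (rule functional_of_l2_series(1)[OF one_in_H2])
        (auto simp: l2_norm_def circle.prob_space[simplified] intro: summable_finite[of "{0}"])
    moreover have "\<phi> (\<lambda>_. 1) \<noteq> 0" by (simp add: \<phi> l2_inner_def circle.prob_space[simplified])
    ultimately have "closure (range (\<lambda>m::nat. \<phi> ((A ^^ m) x))) = UNIV"
      using dense one_in_H2 by blast
    moreover have "\<phi> ((A ^^ m) x) = 0" for m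
      using zero[OF one_in_H2, of m] l2_inner_commute[of "(A ^^ m) x" "\<lambda>_. 1"] by (simp add: \<phi>)
    ultimately have "{0::complex} = UNIV" by simp
    then show False by (metis UNIV_I singletonD zero_neq_one)
  next
    case False
    have hol: "g holomorphic_on ball 0 1" using g_Hinf unfolding Hinfty_def by simp
    have ge: "1 \<le> cmod (g z)" if "cmod z < 1" for z using g_disk that by force
    obtain G where G_meas [measurable]: "G \<in> borel_measurable borel"
      and G: "AE z in ?M. boundary_value g z = G z \<and> (\<lambda>n. g (of_real (rad n) * z)) \<longlonglongrightarrow> G z"
      using Hinfty_boundary_function[OF g_Hinf] by blast
    have Gbv: "AE z in ?M. boundary_value g z = G z" using G by (auto elim: eventually_mono)
    have Glim: "AE z in ?M. (\<lambda>n. g (of_real (rad n) * z)) \<longlonglongrightarrow> G z" using G by (auto elim: eventually_mono)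
    have G1: "AE z in ?M. 1 < cmod (G z)" using g_bd Gbv by eventually_elim simp
    have log: "integrable ?M (\<lambda>z. ln (cmod (G z) - 1))"
    proof (rule integrable_cong_AE_imp[OF g_log])
      show "AE z in ?M. ln (cmod (boundary_value g z) - 1) = ln (cmod (G z) - 1)"
        using Gbv by eventually_elim simp
    qed measurable
    \<comment> \<open>Off the circle \<open>boundary_value g\<close> need not be Borel, so that the integrals in \<open>Tg_proj\<close> can be
      junk zeros; testing against functions supported on a Borel set \<open>Z\<close> of full measure where the
      boundary values agree with \<open>G\<close> avoids this.\<close>
    obtain Z where Z: "Z \<in> sets borel" "AE z in ?M. z \<in> Z" "\<And>z. z \<in> Z \<Longrightarrow> boundary_value g z = G z"
    proof -
      obtain N where N: "N \<in> null_sets ?M" "{z \<in> space ?M. \<not> boundary_value g z = G z} \<subseteq> N"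
        using Gbv by (auto simp: eventually_ae_filter)
      show ?thesis
      proof (rule that[of "- N"])
        show "- N \<in> sets borel" using N(1) by (auto simp: null_sets_def)
        show "AE z in ?M. z \<in> - N" using AE_not_in[OF N(1)] by simp
        show "boundary_value g z = G z" if "z \<in> - N" for z using N(2) that by auto
      qed
    qed
    have adj: "l2_inner f (A y) = l2_inner (\<lambda>z. G z * f z) y"
      if f: "f \<in> H2" and y: "y \<in> H2" and Gf: "(\<lambda>z. G z * f z) \<in> L2T" for f y
    proof -
      note [measurable] = Z(1)
      have [measurable]: "f \<in> borel_measurable borel" "y \<in> borel_measurable borel" "Tg f \<in> borel_measurable borel"
        using f y Tg_maps by (auto intro!: L2T_measurable H2_L2T)
      define h where "h = (\<lambda>z. indicator Z z * y z)"
      have hy: "AE z in ?M. h z = y z" using Z(2) by eventually_elim (simp add: h_def)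
      have [measurable]: "h \<in> borel_measurable borel" unfolding h_def by measurable
      have "h \<in> H2"
      proof -
        have "h \<in> L2T"
          unfolding h_def by (rule L2T_bounded_mult[OF H2_L2T[OF y], where B = 1]) (auto split: split_indicator)
        moreover have "(\<integral>z. h z * z ^ n \<partial>?M) = (\<integral>z. y z * z ^ n \<partial>?M)" for n
          by (rule integral_cong_AE) (use hy in \<open>auto elim!: eventually_mono\<close>)
        ultimately show ?thesis using y unfolding H2_iff_moments by simp
      qed
      then have "l2_inner (\<lambda>z. boundary_value g z * f z - Tg f z) h = 0" using Tg_proj f by blast
      also have "l2_inner (\<lambda>z. boundary_value g z * f z - Tg f z) h = l2_inner (\<lambda>z. G z * f z - Tg f z) h"
        unfolding l2_inner_def using Z(3)
        by (intro Bochner_Integration.integral_cong) (auto simp: h_def split: split_indicator)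
      also have "\<dots> = l2_inner (\<lambda>z. G z * f z - Tg f z) y"
        unfolding l2_inner_def by (rule integral_cong_AE) (use hy in \<open>auto elim!: eventually_mono\<close>)
      also have "\<dots> = l2_inner (\<lambda>z. G z * f z) y - l2_inner (Tg f) y"
        using f y Tg_maps by (intro l2_inner_diff Gf H2_L2T) auto
      finally show ?thesis using A_adj f y by simp
    qed
    obtain c where c: "c > 0" "\<And>m. c * (real m + 1)\<^sup>2 \<le> l2_norm ((A ^^ m) x)"
      using adjoint_orbit_growth[OF hol ge G_meas Glim G1 log _ adj x False] A_maps by blast
    obtain \<phi> where \<phi>: "cont_lin_functional_H2 \<phi>" "\<And>m. c \<le> cmod (\<phi> ((A ^^ m) x))"
      using functional_bounded_below_on_orbit[of "\<lambda>m. (A ^^ m) x", OF orbit c] by blast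
    \<comment> \<open>The lower bound at \<open>m = 0\<close> also shows that the functional is
      nonzero, with \<open>x\<close> as witness, so density applies to it.\<close>
    have "\<phi> ((A ^^ 0) x) \<noteq> 0" using \<phi>(2)[of 0] c(1) by auto
    then have "closure (range (\<lambda>m::nat. \<phi> ((A ^^ m) x))) = UNIV" by (rule dense[OF \<phi>(1) orbit])
    then have "0 \<in> closure (range (\<lambda>m::nat. \<phi> ((A ^^ m) x)))" by simp
    then obtain m where "cmod (\<phi> ((A ^^ m) x)) < c"
      using c(1) unfolding closure_approachable by (auto simp: dist_norm)
    then show False using \<phi>(2)[of m] by simp
  qed
qed

end
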